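(* Let $n\ge4$. Up to isomorphism there is exactly one solvable indecomposable real right Leibniz algebra of dimension $n+2$ whose nilradical is the $n$-dimensional algebra $\mathcal{L}^2$ (codimension two nilradical). It is the algebra $\mathfrak{g}_{n+2,1}$ with basis $e_1,\dots,e_{n+2}$, where $e_1,\dots,e_n$ span $\mathcal{L}^2$ with its defining brackets and the other brackets are $[e_1,e_{n+1}]=e_1-2e_3$, $[e_i,e_{n+1}]=(i-4)e_i$ $(3\le i\le n)$, $[e_{n+1},e_1]=-e_1+2e_3$, $[e_{n+1},e_3]=e_3$, $[e_{n+1},e_4]=e_2$, $[e_{n+1},e_j]=(4-j)e_j$ $(5\le j\le n)$, $[e_1,e_{n+2}]=e_1-e_3$, $[e_2,e_{n+2}]=e_2$, $[e_i,e_{n+2}]=(i-3)e_i$ $(3\le i\le n)$, $[e_{n+2},e_1]=-e_1+e_3$, $[e_{n+2},e_4]=e_2-e_4$, $[e_{n+2},e_j]=(3-j)e_j$ $(5\le j\le n)$, all remaining brackets being zero. Moreover $DS=[n+2,n,n-2,0]$ and $LS=[n+2,n,n,\dots]$.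
   Context: All algebras are finite dimensional over $\mathbb{R}$; brackets not listed are zero. A right Leibniz algebra is a vector space with a bilinear bracket satisfying $[[x,y],z]=[[x,z],y]+[x,[y,z]]$. For a Leibniz algebra $L$: $L^0=L$, $L^{k+1}=[L^k,L]$ (lower central series) and $L^{(0)}=L$, $L^{(k+1)}=[L^{(k)},L^{(k)}]$ (derived series); $L$ is nilpotent (resp. solvable) if some $L^m=0$ (resp. $L^{(m)}=0$). $LS$ and $DS$ denote the lists of dimensions of the terms of the lower central and derived series. The nilradical of a solvable Leibniz algebra is its unique maximal nilpotent ideal. An algebra is indecomposable if it is not a direct sum of two nonzero ideals. For $n\ge4$, $\mathcal{L}^2$ is the $n$-dimensional nilpotent Leibniz algebra with basis $e_1,\dots,e_n$ and only nonzero brackets $[e_1,e_1]=e_2$, $[e_i,e_1]=e_{i+1}$ $(3\le i\le n-1)$, $[e_1,e_3]=e_2-e_4$, $[e_1,e_j]=-e_{j+1}$ $(4\le j\le n-1)$. *)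

theory Defs
  imports "HOL-Analysis.Analysis" "HOL-Analysis.Finite_Function_Topology"
begin

(* An algebra is a pair (V, br): a subspace V of some real vector space together with a
   bracket of which only the values on V matter.  In particular a subalgebra, or an ideal,
   I of (V, br) is the pair (I, br). *)

locale right_leibniz_algebra =
  fixes V :: "'a::real_vector set" and br :: "'a \<Rightarrow> 'a \<Rightarrow> 'a"
  assumes subspace: "subspace V"
    and closed: "x \<in> V \<Longrightarrow> y \<in> V \<Longrightarrow> br x y \<in> V"
    and add_left: "x \<in> V \<Longrightarrow> y \<in> V \<Longrightarrow> z \<in> V \<Longrightarrow> br (x + y) z = br x z + br y z"
    and add_right: "x \<in> V \<Longrightarrow> y \<in> V \<Longrightarrow> z \<in> V \<Longrightarrow> br x (y + z) = br x y + br x z"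
    and scale_left: "x \<in> V \<Longrightarrow> y \<in> V \<Longrightarrow> br (c *\<^sub>R x) y = c *\<^sub>R br x y"
    and scale_right: "x \<in> V \<Longrightarrow> y \<in> V \<Longrightarrow> br x (c *\<^sub>R y) = c *\<^sub>R br x y"
    and leibniz: "x \<in> V \<Longrightarrow> y \<in> V \<Longrightarrow> z \<in> V \<Longrightarrow>
      br (br x y) z = br (br x z) y + br x (br y z)"

(* The map f is required to be linear on the ambient space, which is no restriction:
   a linear map on a subspace extends to the whole space. *)

definition isomorphic_algebras ::
  "'a::real_vector set \<Rightarrow> ('a \<Rightarrow> 'a \<Rightarrow> 'a) \<Rightarrow> 'b::real_vector set \<Rightarrow> ('b \<Rightarrow> 'b \<Rightarrow> 'b) \<Rightarrow> bool" where
  "isomorphic_algebras V br W br' \<longleftrightarrow>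
     (\<exists>f. linear f \<and> bij_betw f V W \<and> (\<forall>x\<in>V. \<forall>y\<in>V. f (br x y) = br' (f x) (f y)))"

definition product_space ::
  "('a::real_vector \<Rightarrow> 'a \<Rightarrow> 'a) \<Rightarrow> 'a set \<Rightarrow> 'a set \<Rightarrow> 'a set" where
  "product_space br A B = span {br a b | a b. a \<in> A \<and> b \<in> B}"

primrec lower_central ::
  "'a::real_vector set \<Rightarrow> ('a \<Rightarrow> 'a \<Rightarrow> 'a) \<Rightarrow> nat \<Rightarrow> 'a set" where
  "lower_central V br 0 = V"
| "lower_central V br (Suc k) = product_space br (lower_central V br k) V"

primrec derived_series ::
  "'a::real_vector set \<Rightarrow> ('a \<Rightarrow> 'a \<Rightarrow> 'a) \<Rightarrow> nat \<Rightarrow> 'a set" where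
  "derived_series V br 0 = V"
| "derived_series V br (Suc k) = product_space br (derived_series V br k) (derived_series V br k)"

definition nilpotent_algebra :: "'a::real_vector set \<Rightarrow> ('a \<Rightarrow> 'a \<Rightarrow> 'a) \<Rightarrow> bool" where
  "nilpotent_algebra V br \<longleftrightarrow> (\<exists>m. lower_central V br m = {0})"

definition solvable_algebra :: "'a::real_vector set \<Rightarrow> ('a \<Rightarrow> 'a \<Rightarrow> 'a) \<Rightarrow> bool" where
  "solvable_algebra V br \<longleftrightarrow> (\<exists>m. derived_series V br m = {0})"

definition two_sided_ideal ::
  "'a::real_vector set \<Rightarrow> ('a \<Rightarrow> 'a \<Rightarrow> 'a) \<Rightarrow> 'a set \<Rightarrow> bool" where
  "two_sided_ideal V br I \<longleftrightarrow>
     subspace I \<and> I \<subseteq> V \<and> (\<forall>x\<in>I. \<forall>y\<in>V. br x y \<in> I \<and> br y x \<in> I)"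

definition maximal_nilpotent_ideal ::
  "'a::real_vector set \<Rightarrow> ('a \<Rightarrow> 'a \<Rightarrow> 'a) \<Rightarrow> 'a set \<Rightarrow> bool" where
  "maximal_nilpotent_ideal V br N \<longleftrightarrow>
     two_sided_ideal V br N \<and> nilpotent_algebra N br \<and>
     (\<forall>M. two_sided_ideal V br M \<and> nilpotent_algebra M br \<and> N \<subseteq> M \<longrightarrow> M = N)"

definition is_nilradical ::
  "'a::real_vector set \<Rightarrow> ('a \<Rightarrow> 'a \<Rightarrow> 'a) \<Rightarrow> 'a set \<Rightarrow> bool" where
  "is_nilradical V br N \<longleftrightarrow>
     maximal_nilpotent_ideal V br N \<and> (\<forall>M. maximal_nilpotent_ideal V br M \<longrightarrow> M = N)"

definition indecomposable_algebra :: "'a::real_vector set \<Rightarrow> ('a \<Rightarrow> 'a \<Rightarrow> 'a) \<Rightarrow> bool" where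
  "indecomposable_algebra V br \<longleftrightarrow>
     \<not> (\<exists>I J. two_sided_ideal V br I \<and> two_sided_ideal V br J \<and> I \<noteq> {0} \<and> J \<noteq> {0} \<and>
          I \<inter> J = {0} \<and> {x + y | x y. x \<in> I \<and> y \<in> J} = V)"

definition DS :: "'a::real_vector set \<Rightarrow> ('a \<Rightarrow> 'a \<Rightarrow> 'a) \<Rightarrow> nat \<Rightarrow> nat" where
  "DS V br k = dim (derived_series V br k)"

definition LS :: "'a::real_vector set \<Rightarrow> ('a \<Rightarrow> 'a \<Rightarrow> 'a) \<Rightarrow> nat \<Rightarrow> nat" where
  "LS V br k = dim (lower_central V br k)"

(* Algebras given by a multiplication table live on the span of e 1, ..., e m inside the
   space of finitely supported sequences; T i j is the bracket of e i and e j. *)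

definition e :: "nat \<Rightarrow> (nat \<Rightarrow>\<^sub>0 real)" where
  "e i = Poly_Mapping.single i 1"

definition table_space :: "nat \<Rightarrow> (nat \<Rightarrow>\<^sub>0 real) set" where
  "table_space m = span (e ` {1..m})"

definition table_bracket ::
  "nat \<Rightarrow> (nat \<Rightarrow> nat \<Rightarrow> (nat \<Rightarrow>\<^sub>0 real)) \<Rightarrow> (nat \<Rightarrow>\<^sub>0 real) \<Rightarrow> (nat \<Rightarrow>\<^sub>0 real) \<Rightarrow> (nat \<Rightarrow>\<^sub>0 real)" where
  "table_bracket m T x y =
     (\<Sum>i\<in>{1..m}. \<Sum>j\<in>{1..m}. (Poly_Mapping.lookup x i * Poly_Mapping.lookup y j) *\<^sub>R T i j)"

definition L2_table :: "nat \<Rightarrow> nat \<Rightarrow> nat \<Rightarrow> (nat \<Rightarrow>\<^sub>0 real)" where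
  "L2_table n i j =
     (if i = 1 \<and> j = 1 then e 2
      else if 3 \<le> i \<and> i \<le> n - 1 \<and> j = 1 then e (i + 1)
      else if i = 1 \<and> j = 3 then e 2 - e 4
      else if i = 1 \<and> 4 \<le> j \<and> j \<le> n - 1 then - e (j + 1)
      else 0)"

definition L2_bracket :: "nat \<Rightarrow> (nat \<Rightarrow>\<^sub>0 real) \<Rightarrow> (nat \<Rightarrow>\<^sub>0 real) \<Rightarrow> (nat \<Rightarrow>\<^sub>0 real)" where
  "L2_bracket n = table_bracket n (L2_table n)"

definition g_table :: "nat \<Rightarrow> nat \<Rightarrow> nat \<Rightarrow> (nat \<Rightarrow>\<^sub>0 real)" where
  "g_table n i j =
     (if i \<le> n \<and> j \<le> n then L2_table n i j
      else if i = 1 \<and> j = n + 1 then e 1 - 2 *\<^sub>R e 3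
      else if 3 \<le> i \<and> i \<le> n \<and> j = n + 1 then (real i - 4) *\<^sub>R e i
      else if i = n + 1 \<and> j = 1 then - e 1 + 2 *\<^sub>R e 3
      else if i = n + 1 \<and> j = 3 then e 3
      else if i = n + 1 \<and> j = 4 then e 2
      else if i = n + 1 \<and> 5 \<le> j \<and> j \<le> n then (4 - real j) *\<^sub>R e j
      else if i = 1 \<and> j = n + 2 then e 1 - e 3
      else if i = 2 \<and> j = n + 2 then e 2
      else if 3 \<le> i \<and> i \<le> n \<and> j = n + 2 then (real i - 3) *\<^sub>R e i
      else if i = n + 2 \<and> j = 1 then - e 1 + e 3
      else if i = n + 2 \<and> j = 4 then e 2 - e 4
      else if i = n + 2 \<and> 5 \<le> j \<and> j \<le> n then (3 - real j) *\<^sub>R e j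
      else 0)"

definition g_bracket :: "nat \<Rightarrow> (nat \<Rightarrow>\<^sub>0 real) \<Rightarrow> (nat \<Rightarrow>\<^sub>0 real) \<Rightarrow> (nat \<Rightarrow>\<^sub>0 real)" where
  "g_bracket n = table_bracket (n + 2) (g_table n)"

definition solvable_indecomposable_ext_L2 ::
  "nat \<Rightarrow> 'a::real_vector set \<Rightarrow> ('a \<Rightarrow> 'a \<Rightarrow> 'a) \<Rightarrow> bool" where
  "solvable_indecomposable_ext_L2 n V br \<longleftrightarrow>
     right_leibniz_algebra V br \<and> dim V = n + 2 \<and>
     solvable_algebra V br \<and> indecomposable_algebra V br \<and>
     (\<exists>N. is_nilradical V br N \<and> isomorphic_algebras N br (table_space n) (L2_bracket n))"

end

theory Submission
  imports Defs
begin

text \<open>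
  On a solvable extension, right multiplications act on the nilradical by derivations. In the basis
  \<open>b 0 = e 1 - e 3, b 1 = e 3, b 2 = e 2, b i = e (i + 1)\<close> every derivation of \<open>L2\<close> is triangular, with
  diagonal \<open>a, d, a + d, d + a, d + 2 a, \<dots>\<close>. The weights \<open>a\<close> and \<open>d\<close> vanish on brackets and on the nilradical.
  By maximality and solvability their common zero set is exactly the nilradical, so they identify the two-dimensional quotient
  with the plane. If \<open>h\<close> has weights \<open>(1, 2)\<close>, right multiplication by \<open>h\<close> is
  invertible on the nilradical, hence its kernel is a complement; being the kernel of a derivation and
  meeting the nilradical trivially, it is an abelian subalgebra. Its elements commute with \<open>h\<close>, so
  they act diagonally on the eigenvectors \<open>f0, f1\<close> of \<open>h\<close> for the eigenvalues 1 and 2, which generate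
  the nilradical. Left multiplications are determined because a sum \<open>[x, y] + [y, x]\<close> is annihilated by all
  left multiplications. Hence the multiplication table is forced, and \<open>e 1 = f0 + f1, e 3 = f1\<close> gives the
  table of \<open>g\<close>.
\<close>

section \<open>The algebra g\<close>

text \<open>The vector \<open>e 1 - e 3\<close> is singled out because it squares to zero. On
  \<open>L2\<close> the symmetrized bracket \<open>[u, v] + [v, u]\<close> is a hyperbolic form in
  the coordinates along \<open>b 0\<close> and \<open>b 1\<close>, times \<open>b 2\<close>. A
  derivation turns \<open>[b 0, b 0] = 0\<close> and \<open>[b 1, b 1] = 0\<close> into vanishing
  symmetrized brackets, which keeps it from mixing the two isotropic lines; the rest of the
  triangular shape follows because \<open>b 0\<close> and \<open>b 1\<close> generate
  \<open>L2\<close>. The weights \<open>(1, 2)\<close> give right multiplication by \<open>h\<close>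
  the diagonal 1, 2, 3, 3, 4, 5, ...: no entry is zero, and 1 and 2 are simple. Solvability enters
  through codimension two: if the brackets filled the quotient by the nilradical, so would every
  term of the derived series. The Leibniz identity makes right multiplications derivations but says
  less about left ones. The relation \<open>[f0, f1] + [f1, f0] = b 2\<close> leaves a trace there:
  it is the source of the summand \<open>e 2\<close> in the brackets of \<open>e (n + 1)\<close> and
  \<open>e (n + 2)\<close> with \<open>e 4\<close>.\<close>

declare add_2_eq_Suc' [simp del]

section \<open>Coordinates, spans and dimensions for finitely supported sequences\<close>

lemma lookup_scaleR: "Poly_Mapping.lookup (c *\<^sub>R x) k = c * Poly_Mapping.lookup x k"
  for x :: "'k \<Rightarrow>\<^sub>0 real"
proof -
  have "finite {i. c * Poly_Mapping.lookup x i \<noteq> 0}"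
    by (rule finite_subset[OF _ finite_lookup[of x]]) auto
  then show ?thesis
    by (simp add: scaleR_poly_mapping_def Abs_poly_mapping_inverse)
qed

lemma lookup_e: "Poly_Mapping.lookup (e i) k = (if i = k then 1 else 0)"
  by (simp add: e_def lookup_single when_def)

lemmas lookup_simps = lookup_e lookup_scaleR lookup_add lookup_minus lookup_uminus

lemma lookup_sum_scaleR:
  "Poly_Mapping.lookup (\<Sum>i\<in>A. c i *\<^sub>R T i) k = (\<Sum>i\<in>A. c i * Poly_Mapping.lookup (T i) k)"
  for T :: "'i \<Rightarrow> 'k \<Rightarrow>\<^sub>0 real"
  by (simp add: lookup_sum lookup_scaleR)

lemma inj_e: "inj e"
  by (metis injI lookup_e one_neq_zero)

lemma span_e_iff:
  assumes "finite S"
  shows "x \<in> span (e ` S) \<longleftrightarrow> (\<forall>k. k \<notin> S \<longrightarrow> Poly_Mapping.lookup x k = 0)"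
proof
  assume "x \<in> span (e ` S)"
  then show "\<forall>k. k \<notin> S \<longrightarrow> Poly_Mapping.lookup x k = 0"
    by (induction rule: span_induct_alt) (auto simp: lookup_simps split: if_splits)
next
  assume *: "\<forall>k. k \<notin> S \<longrightarrow> Poly_Mapping.lookup x k = 0"
  have "x = (\<Sum>i\<in>S. Poly_Mapping.lookup x i *\<^sub>R e i)"
    by (rule poly_mapping_eqI)
      (use * assms in \<open>simp add: lookup_sum_scaleR lookup_e if_distrib sum.delta' cong: if_cong\<close>)
  also have "\<dots> \<in> span (e ` S)"
    by (intro span_sum span_scale span_base) auto
  finally show "x \<in> span (e ` S)" .
qed

lemma independent_e: "independent (e ` S)" if "finite S"
proof
  assume "dependent (e ` S)"
  then obtain a where a: "a \<in> S" "e a \<in> span (e ` S - {e a})"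
    by (auto simp: dependent_def)
  have "e ` S - {e a} = e ` (S - {a})"
    using inj_e by (auto simp: inj_def)
  then have "e a \<in> span (e ` (S - {a}))"
    using a by simp
  then have "Poly_Mapping.lookup (e a) a = 0"
    using that by (subst (asm) span_e_iff) auto
  then show False by (simp add: lookup_e)
qed

lemma dim_span_e: "dim (span (e ` S)) = card S" if "finite S"
  using dim_span_eq_card_independent[OF independent_e[OF that]] card_image[OF inj_on_subset[OF inj_e]]
  by simp

lemma table_space_iff: "x \<in> table_space m \<longleftrightarrow> (\<forall>k. k \<notin> {1..m} \<longrightarrow> Poly_Mapping.lookup x k = 0)"
  by (simp add: table_space_def span_e_iff)

lemma subspace_table_space: "subspace (table_space m)"
  by (simp add: table_space_def)

lemma e_in_table_space: "e i \<in> table_space m" if "1 \<le> i" "i \<le> m"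
  using that by (simp add: table_space_def span_base)

lemma bilinear_table_bracket: "bilinear (table_bracket m T)"
  unfolding bilinear_def table_bracket_def
  by (simp add: linear_iff lookup_simps algebra_simps sum.distrib scaleR_sum_right)

lemma table_bracket_e:
  assumes "i \<in> {1..m}" "j \<in> {1..m}"
  shows "table_bracket m T (e i) (e j) = T i j"
proof -
  have "table_bracket m T (e i) (e j) = (\<Sum>k\<in>{1..m}. \<Sum>l\<in>{1..m}. if i = k then if j = l then T k l else 0 else 0)"
    unfolding table_bracket_def by (intro sum.cong refl) (simp add: lookup_e)
  also have "\<dots> = (\<Sum>k\<in>{1..m}. if i = k then (\<Sum>l\<in>{1..m}. if j = l then T k l else 0) else 0)"
    by (intro sum.cong refl) simp
  also have "\<dots> = T i j"
    using assms by (simp add: sum.delta')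
  finally show ?thesis .
qed

section \<open>The bracket of \<open>g\<close> in coordinates and the Leibniz identity\<close>

lemma bilinear_g: "bilinear (g_bracket n)"
  unfolding g_bracket_def by (rule bilinear_table_bracket)

lemma g_bracket_e: "g_bracket n (e i) (e j) = g_table n i j" if "1 \<le> i" "i \<le> n + 2" "1 \<le> j" "j \<le> n + 2"
  using that by (simp add: g_bracket_def table_bracket_e)

lemma g_bracket_eq_L2_bracket:
  assumes "x \<in> table_space n" "y \<in> table_space n"
  shows "g_bracket n x y = L2_bracket n x y"
proof (rule bilinear_eq[where f = "g_bracket n" and g = "L2_bracket n" and S = "table_space n" and T = "table_space n" and B = "e ` {1..n}" and C = "e ` {1..n}"])
  show "bilinear (g_bracket n)" "bilinear (L2_bracket n)"
    by (simp_all add: g_bracket_def L2_bracket_def bilinear_table_bracket)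
qed (use assms in \<open>auto simp: table_space_def g_bracket_e L2_bracket_def table_bracket_e g_table_def\<close>)

lemma g_table_chain:
  assumes "4 \<le> i" "i \<le> n"
  shows "g_table n (i - 1) 1 = e i"
proof -
  have "i - 1 \<le> n" "i - 1 \<noteq> 1" "3 \<le> i - 1" "i - 1 \<le> n - 1" "i - 1 + 1 = i" "1 \<le> n"
    using assms by auto
  then show ?thesis
    by (simp only: g_table_def L2_table_def if_True if_False simp_thms)
qed

text \<open>The eigenvalues of right multiplication by \<open>x\<close> on the classes of
  \<open>e 1 - e 3\<close> and \<open>e 3\<close>, respectively.\<close>

definition g_wa :: "nat \<Rightarrow> (nat \<Rightarrow>\<^sub>0 real) \<Rightarrow> real" where
  "g_wa n x = Poly_Mapping.lookup x (n + 1) + Poly_Mapping.lookup x (n + 2)"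

definition g_wd :: "nat \<Rightarrow> (nat \<Rightarrow>\<^sub>0 real) \<Rightarrow> real" where
  "g_wd n x = - Poly_Mapping.lookup x (n + 1)"

text \<open>The table in closed form. \<open>X 1\<close> and \<open>X 1 + X 3\<close> are the
  coordinates along \<open>e 1 - e 3\<close> and \<open>e 3\<close>, and the coordinates
  \<open>n + 1\<close> and \<open>n + 2\<close> enter only through the weights, so the double sum
  over the table collapses to a few bilinear terms.\<close>

definition g_coord :: "nat \<Rightarrow> (nat \<Rightarrow>\<^sub>0 real) \<Rightarrow> (nat \<Rightarrow>\<^sub>0 real) \<Rightarrow> nat \<Rightarrow> real" where
  "g_coord n x y k = (let X = Poly_Mapping.lookup x; Y = Poly_Mapping.lookup y;
       ax = g_wa n x; ay = g_wa n y; dx = g_wd n x; dy = g_wd n y in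
     if k = 1 then ay * X 1 - ax * Y 1
     else if k = 2 then (ay + dy) * X 2 + X 1 * (Y 1 + Y 3) + ax * Y 4
     else if k = 3 then dy * (X 1 + X 3) - dx * (Y 1 + Y 3) - (ay * X 1 - ax * Y 1)
     else if k = 4 then (ay + dy) * X 4 + (X 1 + X 3) * Y 1 - X 1 * (Y 1 + Y 3) - (ax + dx) * Y 4
     else if 5 \<le> k \<and> k \<le> n then (dy + (real k - 3) * ay) * X k + X (k - 1) * Y 1
       - X 1 * Y (k - 1) - (dx + (real k - 3) * ax) * Y k
     else 0)"

lemma g_coord_simps:
  "g_coord n x y 1 = g_wa n y * Poly_Mapping.lookup x 1 - g_wa n x * Poly_Mapping.lookup y 1"
  "g_coord n x y 2 = (g_wa n y + g_wd n y) * Poly_Mapping.lookup x 2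
    + Poly_Mapping.lookup x 1 * (Poly_Mapping.lookup y 1 + Poly_Mapping.lookup y 3) + g_wa n x * Poly_Mapping.lookup y 4"
  "g_coord n x y 3 = g_wd n y * (Poly_Mapping.lookup x 1 + Poly_Mapping.lookup x 3)
    - g_wd n x * (Poly_Mapping.lookup y 1 + Poly_Mapping.lookup y 3)
    - (g_wa n y * Poly_Mapping.lookup x 1 - g_wa n x * Poly_Mapping.lookup y 1)"
  "g_coord n x y 4 = (g_wa n y + g_wd n y) * Poly_Mapping.lookup x 4
    + (Poly_Mapping.lookup x 1 + Poly_Mapping.lookup x 3) * Poly_Mapping.lookup y 1
    - Poly_Mapping.lookup x 1 * (Poly_Mapping.lookup y 1 + Poly_Mapping.lookup y 3)
    - (g_wa n x + g_wd n x) * Poly_Mapping.lookup y 4"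
  by (simp_all add: g_coord_def Let_def)

lemma g_coord_ge_5:
  assumes "5 \<le> k" "k \<le> n"
  shows "g_coord n x y k = (g_wd n y + (real k - 3) * g_wa n y) * Poly_Mapping.lookup x k
    + Poly_Mapping.lookup x (k - 1) * Poly_Mapping.lookup y 1 - Poly_Mapping.lookup x 1 * Poly_Mapping.lookup y (k - 1)
    - (g_wd n x + (real k - 3) * g_wa n x) * Poly_Mapping.lookup y k"
  using assms by (simp add: g_coord_def Let_def)

lemma bilinear_g_coord: "bilinear (\<lambda>x y. g_coord n x y k)"
  unfolding bilinear_def linear_iff g_coord_def Let_def g_wa_def g_wd_def
  by (auto simp: lookup_simps) (auto simp: algebra_simps)

lemma lookup_g_table:
  assumes n: "n \<ge> 4" and i: "1 \<le> i" "i \<le> n + 2" and j: "1 \<le> j" "j \<le> n + 2"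
  shows "Poly_Mapping.lookup (g_table n i j) k = g_coord n (e i) (e j) k"
proof -
  have I: "i = 1 \<or> i = 2 \<or> i = 3 \<or> i = 4 \<or> (5 \<le> i \<and> i \<le> n) \<or> i = n + 1 \<or> i = n + 2"
    using i n by linarith
  have J: "j = 1 \<or> j = 2 \<or> j = 3 \<or> j = 4 \<or> (5 \<le> j \<and> j \<le> n) \<or> j = n + 1 \<or> j = n + 2"
    using j n by linarith
  show ?thesis
    using I J n
    by (elim disjE; simp add: g_table_def L2_table_def g_coord_def Let_def g_wa_def g_wd_def lookup_simps; auto)
qed

lemma lookup_g_bracket:
  assumes n: "n \<ge> 4" and "x \<in> table_space (n + 2)" "y \<in> table_space (n + 2)"
  shows "Poly_Mapping.lookup (g_bracket n x y) k = g_coord n x y k"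
proof (rule bilinear_eq[where f = "\<lambda>x y. Poly_Mapping.lookup (g_bracket n x y) k" and g = "\<lambda>x y. g_coord n x y k"
      and S = "table_space (n + 2)" and T = "table_space (n + 2)"
      and B = "e ` {1..n+2}" and C = "e ` {1..n+2}"])
  show "bilinear (\<lambda>x y. Poly_Mapping.lookup (g_bracket n x y) k)"
    using bilinear_g[of n]
    by (simp add: bilinear_def linear_iff lookup_simps)
qed (use assms in \<open>auto simp: table_space_def bilinear_g_coord g_bracket_e lookup_g_table\<close>)


lemma g_bracket_in_table_space:
  assumes "n \<ge> 4" "x \<in> table_space (n + 2)" "y \<in> table_space (n + 2)"
  shows "g_bracket n x y \<in> table_space n"
  unfolding table_space_iff lookup_g_bracket[OF assms]
  using assms(1) by (auto simp: g_coord_def Let_def)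

lemma table_space_mono: "x \<in> table_space m \<Longrightarrow> m \<le> m' \<Longrightarrow> x \<in> table_space m'"
  by (auto simp: table_space_iff)

text \<open>Brackets have weight zero and each coordinate of a bracket involves boundedly many
  others, so the identity is a small polynomial identity in each coordinate.\<close>

lemma g_right_leibniz:
  assumes n: "n \<ge> 4"
  shows "right_leibniz_algebra (table_space (n + 2)) (g_bracket n)"
proof
  show "subspace (table_space (n + 2))"
    by (rule subspace_table_space)
next
  fix x y assume "x \<in> table_space (n + 2)" "y \<in> table_space (n + 2)"
  then show "g_bracket n x y \<in> table_space (n + 2)"
    using g_bracket_in_table_space[OF n] table_space_mono by fastforce
next
  fix x y z assume xyz: "x \<in> table_space (n + 2)" "y \<in> table_space (n + 2)" "z \<in> table_space (n + 2)"
  let ?b = "g_bracket n"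
  have cl: "?b u v \<in> table_space (n + 2)" if "u \<in> table_space (n + 2)" "v \<in> table_space (n + 2)" for u v
    using g_bracket_in_table_space[OF n that] table_space_mono by fastforce
  have w: "g_wa n (?b u v) = 0" "g_wd n (?b u v) = 0" if "u \<in> table_space (n + 2)" "v \<in> table_space (n + 2)" for u v
    using n by (simp_all add: g_wa_def g_wd_def lookup_g_bracket[OF n that] g_coord_def Let_def)
  note lk = lookup_g_bracket[OF n]
  note c1 = trans[OF lk g_coord_simps(1)] and c2 = trans[OF lk g_coord_simps(2)]
    and c3 = trans[OF lk g_coord_simps(3)] and c4 = trans[OF lk g_coord_simps(4)]
  have c5: "Poly_Mapping.lookup (?b u v) k = (g_wd n v + (real k - 3) * g_wa n v) * Poly_Mapping.lookup u k
      + Poly_Mapping.lookup u (k - 1) * Poly_Mapping.lookup v 1 - Poly_Mapping.lookup u 1 * Poly_Mapping.lookup v (k - 1)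
      - (g_wd n u + (real k - 3) * g_wa n u) * Poly_Mapping.lookup v k"
    if "5 \<le> k" "k \<le> n" "u \<in> table_space (n + 2)" "v \<in> table_space (n + 2)" for u v k
    using trans[OF lk[OF that(3,4)] g_coord_ge_5[OF that(1,2)]] .
  show "?b (?b x y) z = ?b (?b x z) y + ?b x (?b y z)"
  proof (rule poly_mapping_eqI)
    fix k
    \<comment> \<open>Coordinate \<open>k\<close> of an iterated bracket refers to
      \<open>k - 1\<close> and then \<open>k - 2\<close>. At \<open>k = 5\<close> the predecessor 4
      obeys its own formula, hence the separate case.\<close>
    consider "k = 1" | "k = 2" | "k = 3" | "k = 4" | "k = 5" "k \<le> n" | "6 \<le> k" "k \<le> n" | "k = 0 \<or> n < k"
      using n by linarith
    then show "Poly_Mapping.lookup (?b (?b x y) z) k = Poly_Mapping.lookup (?b (?b x z) y + ?b x (?b y z)) k"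
    proof cases
      case 1
      show ?thesis
        unfolding 1 by (simp only: lookup_add c1 cl w xyz) (simp add: algebra_simps)
    next
      case 2
      show ?thesis
        unfolding 2 by (simp only: lookup_add c1 c2 c3 c4 cl w xyz) (simp add: algebra_simps)
    next
      case 3
      show ?thesis
        unfolding 3 by (simp only: lookup_add c1 c3 cl w xyz) (simp add: algebra_simps)
    next
      case 4
      show ?thesis
        unfolding 4 by (simp only: lookup_add c1 c3 c4 cl w xyz) (simp add: algebra_simps)
    next
      case 5
      have "(5::nat) - 1 = 4" by simp
      note c5' = c5[of 5, OF order_refl 5(2)[unfolded 5(1)], unfolded this]
      show ?thesis
        unfolding 5 by (simp only: lookup_add c1 c3 c4 c5' cl w xyz) (simp add: algebra_simps)
    next
      case 6
      define m where "m = k - 1"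
      have m: "5 \<le> m" "m \<le> n" and k: "5 \<le> k" "k \<le> n"
        using 6 unfolding m_def by arith+
      have rm: "real m = real k - 1"
        using k unfolding m_def by (simp only: of_nat_diff)
      show ?thesis
        by (simp only: lookup_add c1 c5[OF k, folded m_def] c5[OF m] cl w xyz rm) (simp add: algebra_simps)
    next
      case 7
      then have "g_coord n u v k = 0" for u v
        using n by (auto simp: g_coord_def Let_def)
      then show ?thesis
        by (simp only: lookup_add lk cl xyz add_0)
    qed
  qed
qed (simp_all add: bilinear_ladd bilinear_radd bilinear_lmul bilinear_rmul bilinear_g)

section \<open>Derived and lower central series of \<open>g\<close>\<close>

lemma subspace_product_space: "subspace (product_space br A B)"
  by (simp add: product_space_def)

lemma br_in_product_space: "a \<in> A \<Longrightarrow> b \<in> B \<Longrightarrow> br a b \<in> product_space br A B"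
  unfolding product_space_def by (rule span_base) blast

lemma product_space_subset:
  assumes "\<And>a b. a \<in> A \<Longrightarrow> b \<in> B \<Longrightarrow> br a b \<in> S" "subspace S"
  shows "product_space br A B \<subseteq> S"
  unfolding product_space_def using assms by (intro span_minimal) auto

text \<open>With \<open>W\<close> the whole algebra this is the first step of both series; with
  \<open>W = table_space n\<close> it makes the lower central series stationary afterwards.\<close>

lemma g_product_space:
  assumes n: "n \<ge> 4" and W: "W = table_space n \<or> W = table_space (n + 2)"
  shows "product_space (g_bracket n) W (table_space (n + 2)) = table_space n" (is "?P = _")
proof
  have "W \<subseteq> table_space (n + 2)"
    using W table_space_mono by fastforce
  then show "?P \<subseteq> table_space n"
    using g_bracket_in_table_space[OF n] subspace_table_space by (intro product_space_subset) auto
next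
  have br: "g_table n i j \<in> ?P" if "1 \<le> i" "i \<le> n" "1 \<le> j" "j \<le> n + 2" for i j
    using W that by (subst g_bracket_e[symmetric]) (auto intro!: br_in_product_space e_in_table_space)
  have "e i \<in> ?P" if "i \<in> {1..n}" for i
  proof -
    note sub = subspace_product_space[of "g_bracket n" W "table_space (n + 2)"]
    \<comment> \<open>Right multiplications by \<open>e (n + 2)\<close> and \<open>e (n + 1)\<close>
      differ on \<open>e 1\<close> by exactly \<open>e 3\<close>.\<close>
    have e3: "e 3 \<in> ?P"
      using subspace_diff[OF sub br[of 1 "n + 2"] br[of 1 "n + 1"]] n by (simp add: g_table_def scaleR_2)
    have "i = 1 \<or> i = 2 \<or> i = 3 \<or> 4 \<le> i \<and> i \<le> n"
      using \<open>i \<in> {1..n}\<close> by simp arith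
    then consider "i = 1" | "i = 2" | "i = 3" | "4 \<le> i" "i \<le> n" by blast
    then show ?thesis
    proof cases
      case 1
      then show ?thesis
        using subspace_add[OF sub br[of 1 "n + 2"] e3] n by (simp add: g_table_def)
    next
      case 2
      then show ?thesis using br[of 1 1] n by (simp add: g_table_def L2_table_def)
    next
      case 3
      then show ?thesis using e3 by simp
    next
      case 4
      then show ?thesis
        using br[of "i - 1" 1] n g_table_chain[of i n] by force
    qed
  qed
  then show "table_space n \<subseteq> ?P"
    unfolding table_space_def[of n] by (intro span_minimal subspace_product_space) auto
qed

lemma table_space_weight_zero:
  assumes "x \<in> table_space n"
  shows "g_wa n x = 0" "g_wd n x = 0"
  using assms by (simp_all add: table_space_iff g_wa_def g_wd_def)

text \<open>The derived algebra of \<open>L2\<close>: only the indices 1 and 3 of the two generators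
  are missing.\<close>

definition L2_derived :: "nat \<Rightarrow> (nat \<Rightarrow>\<^sub>0 real) set" where
  "L2_derived n = span (e ` ({2} \<union> {4..n}))"

lemma L2_derived_iff:
  assumes "n \<ge> 4"
  shows "x \<in> L2_derived n \<longleftrightarrow> x \<in> table_space n \<and> Poly_Mapping.lookup x 1 = 0 \<and> Poly_Mapping.lookup x 3 = 0"
proof -
  have "k \<notin> {2} \<union> {4..n} \<longleftrightarrow> k \<notin> {1..n} \<or> k = 1 \<or> k = 3" for k
    using assms by auto
  then show ?thesis
    unfolding L2_derived_def table_space_iff by (subst span_e_iff) auto
qed

lemma subspace_L2_derived: "subspace (L2_derived n)"
  by (simp add: L2_derived_def)

text \<open>Vanishing weights strip \<open>g_coord\<close> down to the bracket of \<open>L2\<close>.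
  The same formula later computes brackets in an abstract copy of \<open>L2\<close>.\<close>

lemma lookup_g_bracket_table_space:
  assumes n: "n \<ge> 4" and a: "a \<in> table_space n" and b: "b \<in> table_space n"
  shows "Poly_Mapping.lookup (g_bracket n a b) k = (let X = Poly_Mapping.lookup a; Y = Poly_Mapping.lookup b in
    if k = 2 then X 1 * (Y 1 + Y 3)
    else if k = 4 then (X 1 + X 3) * Y 1 - X 1 * (Y 1 + Y 3)
    else if 5 \<le> k \<and> k \<le> n then X (k - 1) * Y 1 - X 1 * Y (k - 1) else 0)"
proof -
  have ab': "a \<in> table_space (n + 2)" "b \<in> table_space (n + 2)"
    using a b table_space_mono by fastforce+
  show ?thesis
    using n by (simp add: lookup_g_bracket[OF n ab'] g_coord_def Let_def table_space_weight_zero[OF a] table_space_weight_zero[OF b])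
qed

lemma g_product_space_table_space:
  assumes n: "n \<ge> 4"
  shows "product_space (g_bracket n) (table_space n) (table_space n) = L2_derived n" (is "?P = _")
proof
  have "g_bracket n a b \<in> L2_derived n" if "a \<in> table_space n" "b \<in> table_space n" for a b
    using n that by (auto simp: L2_derived_iff table_space_iff[of "g_bracket n a b"] lookup_g_bracket_table_space Let_def)
  then show "?P \<subseteq> L2_derived n"
    by (intro product_space_subset subspace_L2_derived)
next
  have br: "g_table n i j \<in> ?P" if "1 \<le> i" "i \<le> n" "1 \<le> j" "j \<le> n" for i j
    using that by (subst g_bracket_e[symmetric]) (auto intro!: br_in_product_space e_in_table_space)
  have "e i \<in> ?P" if "i \<in> {4..n}" for i
    using br[of "i - 1" 1] n that g_table_chain[of i n] by force
  moreover have "e 2 \<in> ?P"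
    using br[of 1 1] n by (simp add: g_table_def L2_table_def)
  ultimately show "L2_derived n \<subseteq> ?P"
    unfolding L2_derived_def by (intro span_minimal subspace_product_space) auto
qed

lemma g_product_space_L2_derived:
  assumes n: "n \<ge> 4"
  shows "product_space (g_bracket n) (L2_derived n) (L2_derived n) = {0}" (is "?P = _")
proof
  have "g_bracket n a b \<in> {0}" if "a \<in> L2_derived n" "b \<in> L2_derived n" for a b
    using n that by (auto simp: L2_derived_iff lookup_g_bracket_table_space Let_def intro!: poly_mapping_eqI)
  then show "?P \<subseteq> {0}"
    by (intro product_space_subset) (auto simp: subspace_def)
qed (use subspace_0[OF subspace_product_space] in auto)

lemma g_derived_series:
  assumes "n \<ge> 4"
  shows "derived_series (table_space (n + 2)) (g_bracket n) (Suc 0) = table_space n"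
    "derived_series (table_space (n + 2)) (g_bracket n) (Suc (Suc 0)) = L2_derived n"
    "derived_series (table_space (n + 2)) (g_bracket n) (Suc (Suc (Suc 0))) = {0}"
  using assms by (simp_all add: g_product_space g_product_space_table_space g_product_space_L2_derived)

lemma g_lower_central:
  assumes "n \<ge> 4"
  shows "lower_central (table_space (n + 2)) (g_bracket n) (Suc k) = table_space n"
  by (induction k) (use assms in \<open>simp_all add: g_product_space\<close>)

lemma dim_table_space: "dim (table_space m) = m"
  unfolding table_space_def by (subst dim_span_e) auto

lemma g_DS:
  assumes n: "n \<ge> 4"
  shows "map (DS (table_space (n + 2)) (g_bracket n)) [0..<4] = [n + 2, n, n - 2, 0]"
proof -
  have "card (({2::nat} \<union> {4..n})) = n - 2"
    using n by (subst card_Un_disjoint) auto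
  then have "dim (L2_derived n) = n - 2"
    unfolding L2_derived_def by (subst dim_span_e) auto
  moreover have "dim {0 :: nat \<Rightarrow>\<^sub>0 real} = 0"
    using dim_span[of "{0 :: nat \<Rightarrow>\<^sub>0 real}"] dim_eq_card_independent[of "{} :: (nat \<Rightarrow>\<^sub>0 real) set"]
    by (simp add: span_eq_dim[of "{0}" "{}"] independent_empty)
  moreover have "[0..<4] = [0, Suc 0, Suc (Suc 0), Suc (Suc (Suc 0))]"
    by (simp add: upt_rec)
  ultimately show ?thesis
    by (simp add: DS_def g_derived_series[OF n] dim_table_space del: derived_series.simps(2))
qed

section \<open>The nilradical of \<open>g\<close>\<close>

lemma g_ideal_table_space:
  assumes n: "n \<ge> 4"
  shows "two_sided_ideal (table_space (n + 2)) (g_bracket n) (table_space n)"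
  unfolding two_sided_ideal_def
  using g_bracket_in_table_space[OF n] table_space_mono[of _ n "n + 2"] by (auto simp: subspace_table_space)

lemma L2_nilpotent:
  assumes n: "n \<ge> 4"
  shows "nilpotent_algebra (table_space n) (g_bracket n)"
proof -
  let ?L = "lower_central (table_space n) (g_bracket n)"
  \<comment> \<open>The regular index shift starts only after two steps: the first term still
    contains \<open>e 2\<close>, which the next multiplication kills.\<close>
  have "?L (Suc (Suc k)) \<subseteq> span (e ` {k + 5..n})" for k
  proof (induction k)
    case 0
    have "g_bracket n a b \<in> span (e ` {5..n})" if "a \<in> L2_derived n" and "b \<in> table_space n" for a b
      using n that by (auto simp: L2_derived_iff span_e_iff lookup_g_bracket_table_space Let_def)
    then show ?case
      using n by (simp add: g_product_space_table_space product_space_subset)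
  next
    case (Suc k)
    have "g_bracket n a b \<in> span (e ` {Suc k + 5..n})" if a: "a \<in> span (e ` {k + 5..n})" and b: "b \<in> table_space n" for a b
    proof -
      have N: "a \<in> table_space n"
        using a by (auto simp: table_space_iff span_e_iff)
      have "Poly_Mapping.lookup a i = 0" if "i < k + 5" for i
        using a that by (auto simp: span_e_iff)
      then show ?thesis
        using n b N by (auto simp: span_e_iff lookup_g_bracket_table_space Let_def)
    qed
    then show ?case
      using Suc.IH by (subst lower_central.simps) (rule product_space_subset, auto)
  qed
  from this[of n] have "?L (Suc (Suc n)) \<subseteq> {0}"
    by simp
  moreover have "0 \<in> ?L (Suc (Suc n))"
    using subspace_0[OF subspace_product_space] by simp
  ultimately show ?thesis
    unfolding nilpotent_algebra_def by blast
qed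

text \<open>If a weight of \<open>x\<close> is nonzero, right multiplication by \<open>x\<close> has
  an eigenfunctional on \<open>table_space n\<close> with nonzero eigenvalue, so its iterates never
  die and the lower central series of an ideal containing \<open>x\<close> cannot end in zero. This
  gives uniqueness of the nilradical.\<close>

lemma nilpotent_ideal_subset:
  assumes n: "n \<ge> 4" and M: "two_sided_ideal (table_space (n + 2)) (g_bracket n) M"
    and nil: "nilpotent_algebra M (g_bracket n)"
  shows "M \<subseteq> table_space n"
proof
  fix x assume x: "x \<in> M"
  then have xV: "x \<in> table_space (n + 2)"
    using M by (auto simp: two_sided_ideal_def)
  obtain m where m: "lower_central M (g_bracket n) m = {0}"
    using nil by (auto simp: nilpotent_algebra_def)
  \<comment> \<open>The vector \<open>u\<close> may lie outside \<open>M\<close>, but its bracket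
    with \<open>x\<close> is inside. The functionals used are the coordinates along
    \<open>e 1 - e 3\<close> and \<open>e 3\<close>.\<close>
  have iter: "\<exists>v \<in> lower_central M (g_bracket n) k. v \<in> table_space n \<and> p v \<noteq> 0"
    if p: "\<And>v. v \<in> table_space n \<Longrightarrow> p (g_bracket n v x) = c * p v" and c: "c \<noteq> 0"
      and u: "u \<in> table_space n" "p u \<noteq> 0" for p and c :: real and u k
  proof (induction k)
    case 0
    have uV: "u \<in> table_space (n + 2)"
      using u(1) by (rule table_space_mono) simp
    then have "g_bracket n u x \<in> M"
      using M x by (auto simp: two_sided_ideal_def)
    moreover have "p (g_bracket n u x) \<noteq> 0"
      using p[OF u(1)] c u(2) by simp
    ultimately show ?case
      using g_bracket_in_table_space[OF n uV xV] by (intro bexI[of _ "g_bracket n u x"]) simp_all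
  next
    case (Suc k)
    then obtain v where v: "v \<in> lower_central M (g_bracket n) k" "v \<in> table_space n" "p v \<noteq> 0"
      by blast
    have "g_bracket n v x \<in> lower_central M (g_bracket n) (Suc k)"
      using v x by (simp add: br_in_product_space)
    moreover have "g_bracket n v x \<in> table_space n"
      using table_space_mono[OF v(2), of "n + 2"] by (simp add: g_bracket_in_table_space[OF n _ xV])
    moreover have "p (g_bracket n v x) \<noteq> 0"
      using p[OF v(2)] c v(3) by simp
    ultimately show ?case by (intro bexI[of _ "g_bracket n v x"] conjI)
  qed
  have V: "v \<in> table_space (n + 2)" if "v \<in> table_space n" for v
    using that table_space_mono by fastforce
  have "g_wa n x = 0"
  proof (rule ccontr)
    assume "g_wa n x \<noteq> 0"
    then have "\<exists>v \<in> lower_central M (g_bracket n) m. v \<in> table_space n \<and> Poly_Mapping.lookup v 1 \<noteq> 0"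
      by (rule iter[rotated, where u = "e 1"])
        (use n in \<open>auto simp: lookup_g_bracket[OF n V xV] g_coord_def Let_def table_space_weight_zero lookup_e e_in_table_space\<close>)
    with m show False by auto
  qed
  moreover have "g_wd n x = 0"
  proof (rule ccontr)
    assume "g_wd n x \<noteq> 0"
    then have "\<exists>v \<in> lower_central M (g_bracket n) m. v \<in> table_space n \<and>
        Poly_Mapping.lookup v 1 + Poly_Mapping.lookup v 3 \<noteq> 0"
      by (rule iter[rotated, where u = "e 3"])
        (use n in \<open>auto simp: lookup_g_bracket[OF n V xV] g_coord_def Let_def table_space_weight_zero lookup_e e_in_table_space\<close>)
    with m show False by auto
  qed
  ultimately have "Poly_Mapping.lookup x (n + 1) = 0" "Poly_Mapping.lookup x (n + 2) = 0"
    by (simp_all add: g_wa_def g_wd_def)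
  moreover have "k \<notin> {1..n} \<Longrightarrow> k \<in> {1..n+2} \<Longrightarrow> k = n + 1 \<or> k = n + 2" for k
    by auto
  ultimately show "x \<in> table_space n"
    using xV unfolding table_space_iff by metis
qed

lemma g_nilradical:
  assumes n: "n \<ge> 4"
  shows "is_nilradical (table_space (n + 2)) (g_bracket n) (table_space n)"
  unfolding is_nilradical_def maximal_nilpotent_ideal_def
  using g_ideal_table_space[OF n] L2_nilpotent[OF n] nilpotent_ideal_subset[OF n] by blast

section \<open>Indecomposability of \<open>g\<close>\<close>

lemma eigenvector_in_ideal:
  assumes V: "right_leibniz_algebra V br"
    and I: "two_sided_ideal V br I" and J: "two_sided_ideal V br J" and IJ: "I \<inter> J = {0}"
    and sum: "{x + y | x y. x \<in> I \<and> y \<in> J} = V"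
    and h: "h \<in> V" and p: "p \<in> V" "br p h = c *\<^sub>R p"
    and eig: "\<And>v. v \<in> V \<Longrightarrow> br v h = c *\<^sub>R v \<Longrightarrow> \<exists>s. v = s *\<^sub>R p"
  shows "p \<in> I \<or> p \<in> J"
proof -
  interpret right_leibniz_algebra V br by (rule V)
  have sI: "subspace I" "I \<subseteq> V" and sJ: "subspace J" "J \<subseteq> V"
    using I J by (auto simp: two_sided_ideal_def)
  obtain i j where ij: "i \<in> I" "j \<in> J" "p = i + j"
    using p(1) sum by blast
  have iV: "i \<in> V" and jV: "j \<in> V"
    using ij sI sJ by blast+
  have "br i h + br j h = br p h"
    unfolding ij(3) by (rule add_left[OF iV jV h, symmetric])
  also have "\<dots> = c *\<^sub>R i + c *\<^sub>R j"
    unfolding p(2) unfolding ij(3) by (rule scaleR_add_right)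
  finally have "br i h + br j h = c *\<^sub>R i + c *\<^sub>R j" .
  \<comment> \<open>One side lies in \<open>I\<close>, the other in \<open>J\<close>, so both
    vanish. Each component of \<open>p\<close> is then an eigenvector for \<open>c\<close>, hence a
    multiple of \<open>p\<close>.\<close>
  then have eq: "br i h - c *\<^sub>R i = c *\<^sub>R j - br j h"
    by (simp add: algebra_simps)
  have "br i h \<in> I" "br j h \<in> J"
    using I J ij h unfolding two_sided_ideal_def by blast+
  then have "br i h - c *\<^sub>R i \<in> I" "c *\<^sub>R j - br j h \<in> J"
    using subspace_diff[OF sI(1) _ subspace_scale[OF sI(1) ij(1)]]
      subspace_diff[OF sJ(1) subspace_scale[OF sJ(1) ij(2)]] by blast+
  then have "br i h - c *\<^sub>R i \<in> I \<inter> J"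
    unfolding eq by blast
  then have "br i h - c *\<^sub>R i = 0"
    unfolding IJ by blast
  then have "br i h = c *\<^sub>R i" "br j h = c *\<^sub>R j"
    using eq by simp_all
  then obtain s t where st: "i = s *\<^sub>R p" "j = t *\<^sub>R p"
    using eig[OF iV] eig[OF jV] by blast
  show ?thesis
  proof (cases "s = 0")
    case False
    then have "(1 / s) *\<^sub>R i = p" unfolding st(1) by simp
    then show ?thesis using subspace_scale[OF sI(1) ij(1), of "1 / s"] by simp
  next
    case True
    then have "i = 0" unfolding st(1) by simp
    then show ?thesis using ij(2) unfolding ij(3) by simp
  qed
qed

text \<open>The eigenvectors \<open>e 1 - e 3\<close> and \<open>e 3\<close> have simple
  eigenvalues, so each lies in a summand, and their nonzero bracket puts both into the same one.
  That summand contains the nilradical they generate; the other one is annihilated by it, so has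
  weight zero and lies in the nilradical itself.\<close>

lemma g_indecomposable:
  assumes n: "n \<ge> 4"
  shows "indecomposable_algebra (table_space (n + 2)) (g_bracket n)"
  unfolding indecomposable_algebra_def
proof (clarify)
  fix I J
  let ?V = "table_space (n + 2)" and ?b = "g_bracket n"
  assume I: "two_sided_ideal ?V ?b I" and J: "two_sided_ideal ?V ?b J"
    and I0: "I \<noteq> {0}" and J0: "J \<noteq> {0}" and IJ: "I \<inter> J = {0}"
    and sum: "{x + y | x y. x \<in> I \<and> y \<in> J} = ?V"
  \<comment> \<open>The weights of \<open>e (n + 1)\<close> and \<open>e (n + 2)\<close> are
    \<open>(1, -1)\<close> and \<open>(1, 0)\<close>; this combination has weights
    \<open>(1, 2)\<close>.\<close>
  define h where "h = 3 *\<^sub>R e (n + 2) - 2 *\<^sub>R e (n + 1)"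
  have eV: "e i \<in> ?V" if "1 \<le> i" "i \<le> n + 2" for i
    using that by (rule e_in_table_space)
  have hV: "h \<in> ?V"
    unfolding h_def by (intro subspace_diff subspace_scale subspace_table_space eV) auto
  have wh: "g_wa n h = 1" "g_wd n h = 2"
    by (auto simp: h_def g_wa_def g_wd_def lookup_simps)
  have hk: "Poly_Mapping.lookup h k = 0" if "k \<le> n" for k
    using that by (auto simp: h_def lookup_simps)
  have coord: "g_coord n v h k = (if k = 1 then Poly_Mapping.lookup v 1
     else if k = 2 then 3 * Poly_Mapping.lookup v 2
     else if k = 3 then 2 * Poly_Mapping.lookup v 3 + Poly_Mapping.lookup v 1
     else if 4 \<le> k \<and> k \<le> n then (real k - 1) * Poly_Mapping.lookup v k else 0)" for v k
    using n by (auto simp: g_coord_def Let_def wh hk algebra_simps)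
  define f where "f = e 1 - e 3"
  have fV: "f \<in> ?V"
    unfolding f_def using n by (intro subspace_diff subspace_table_space eV) auto
  have f: "f \<in> I \<or> f \<in> J"
  proof (rule eigenvector_in_ideal[OF g_right_leibniz[OF n] I J IJ sum hV fV, where c = 1])
    show "?b f h = 1 *\<^sub>R f"
      using n by (intro poly_mapping_eqI) (use lookup_g_bracket[OF n fV hV] in \<open>auto simp: coord f_def lookup_simps\<close>)
  next
    fix v assume v: "v \<in> ?V" "?b v h = 1 *\<^sub>R v"
    have eq: "g_coord n v h k = Poly_Mapping.lookup v k" for k
      using v lookup_g_bracket[OF n v(1) hV, of k] by simp
    have "v = Poly_Mapping.lookup v 1 *\<^sub>R f"
    proof (rule poly_mapping_eqI)
      fix k show "Poly_Mapping.lookup v k = Poly_Mapping.lookup (Poly_Mapping.lookup v 1 *\<^sub>R f) k"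
        using eq[of k] n by (auto simp: coord f_def lookup_simps split: if_splits)
    qed
    then show "\<exists>s. v = s *\<^sub>R f" by blast
  qed
  have e3: "e 3 \<in> I \<or> e 3 \<in> J"
  proof (rule eigenvector_in_ideal[OF g_right_leibniz[OF n] I J IJ sum hV, where c = 2])
    show e3V: "e 3 \<in> ?V" using n by (simp add: eV)
    show "?b (e 3) h = 2 *\<^sub>R e 3"
      using n by (intro poly_mapping_eqI) (auto simp: lookup_g_bracket[OF n e3V hV] coord lookup_simps)
  next
    fix v assume v: "v \<in> ?V" "?b v h = 2 *\<^sub>R v"
    have eq: "g_coord n v h k = 2 * Poly_Mapping.lookup v k" for k
      using v lookup_g_bracket[OF n v(1) hV, of k] by (simp add: lookup_scaleR)
    have "v = Poly_Mapping.lookup v 3 *\<^sub>R e 3"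
    proof (rule poly_mapping_eqI)
      fix k show "Poly_Mapping.lookup v k = Poly_Mapping.lookup (Poly_Mapping.lookup v 3 *\<^sub>R e 3) k"
        using eq[of k] n by (auto simp: coord lookup_simps split: if_splits)
    qed
    then show "\<exists>s. v = s *\<^sub>R e 3" by blast
  qed
  \<comment> \<open>Stated for fresh \<open>I\<close> and \<open>J\<close>, since either summand may
    be the one containing \<open>f\<close>.\<close>
  have zero: "J \<subseteq> {0}"
    if I: "two_sided_ideal ?V ?b I" and J: "two_sided_ideal ?V ?b J" and IJ: "I \<inter> J = {0}"
      and f: "f \<in> I" and e3: "e 3 \<in> I \<or> e 3 \<in> J" for I J
  proof
    fix x assume x: "x \<in> J"
    have sI: "subspace I" "I \<subseteq> ?V" and sJ: "subspace J" "J \<subseteq> ?V"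
      and bI: "\<And>u v. u \<in> I \<Longrightarrow> v \<in> ?V \<Longrightarrow> ?b u v \<in> I" "\<And>u v. u \<in> ?V \<Longrightarrow> v \<in> I \<Longrightarrow> ?b u v \<in> I"
      and bJ: "\<And>u v. u \<in> J \<Longrightarrow> v \<in> ?V \<Longrightarrow> ?b u v \<in> J" "\<And>u v. u \<in> ?V \<Longrightarrow> v \<in> J \<Longrightarrow> ?b u v \<in> J"
      using I J unfolding two_sided_ideal_def by blast+
    have "?b (e 3) f = e 4"
      using n by (simp add: f_def bilinear_rsub[OF bilinear_g] g_bracket_e g_table_def L2_table_def)
    moreover have "e 4 \<noteq> 0"
      using lookup_e[of 4 4] by (metis lookup_zero zero_neq_one)
    ultimately have e3: "e 3 \<in> I"
      using e3 bI(2)[of "e 3" f] bJ(1)[of "e 3" f] IJ fV eV[of 3] f n by auto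
    have e1: "e 1 \<in> I"
      using subspace_add[OF sI(1) f e3] by (simp add: f_def)
    have eI: "e i \<in> I" if "i \<in> {1..n}" for i
    proof -
      have "i = 1 \<or> i = 2 \<or> i = 3 \<or> 4 \<le> i \<and> i \<le> n"
      using \<open>i \<in> {1..n}\<close> by simp arith
    then consider "i = 1" | "i = 2" | "i = 3" | "4 \<le> i" "i \<le> n" by blast
      then show ?thesis
      proof cases
        case 2
        then show ?thesis using bI(1)[OF e1, of "e 1"] n eV[of 1] by (simp add: g_bracket_e g_table_def L2_table_def)
      next
        case 4
        then show ?thesis
          using bI(2)[OF _ e1, of "e (i - 1)"] n eV[of "i - 1"] g_table_chain[of i n] g_bracket_e[of "i - 1" n 1]
          by (simp del: One_nat_def)
      qed (use e1 e3 in auto)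
    qed
    then have NI: "table_space n \<subseteq> I"
      unfolding table_space_def using sI(1) by (intro span_minimal) auto
    have xV: "x \<in> ?V" using x sJ by auto
    have "?b u x = 0" if "u \<in> I" for u
      using bI(1)[of u x] bJ(2)[of u x] that x xV sI IJ by blast
    then have c: "g_coord n u x k = 0" if "u \<in> I" for u k
      using lookup_g_bracket[OF n _ xV, of u k] that sI by auto
    have "g_wa n x = 0"
      using c[OF e1, of 1] n by (simp add: g_coord_def Let_def lookup_e g_wa_def)
    moreover have "g_wd n x = 0"
      using c[OF e3, of 3] n by (simp add: g_coord_def Let_def lookup_e g_wa_def g_wd_def)
    ultimately have "Poly_Mapping.lookup x (n + 1) = 0" "Poly_Mapping.lookup x (n + 2) = 0"
      by (simp_all add: g_wa_def g_wd_def)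
    moreover have "k \<notin> {1..n} \<Longrightarrow> k \<in> {1..n+2} \<Longrightarrow> k = n + 1 \<or> k = n + 2" for k
      by auto
    ultimately have "x \<in> table_space n"
      using xV unfolding table_space_iff by metis
    then show "x \<in> {0}" using x NI IJ by blast
  qed
  have "I \<noteq> {0} \<and> J \<noteq> {0} \<and> (J \<subseteq> {0} \<or> I \<subseteq> {0})"
    using f e3 zero[OF I J IJ] zero[OF J I] IJ I0 J0 by (auto simp: Int_commute)
  moreover have "0 \<in> I" "0 \<in> J" using IJ by auto
  ultimately show False by auto
qed

lemma g_solvable_indecomposable_ext:
  assumes n: "n \<ge> 4"
  shows "solvable_indecomposable_ext_L2 n (table_space (n + 2)) (g_bracket n)"
  unfolding solvable_indecomposable_ext_L2_def
proof (intro conjI exI)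
  show "solvable_algebra (table_space (n + 2)) (g_bracket n)"
    unfolding solvable_algebra_def using g_derived_series(3)[OF n] by blast
  show "isomorphic_algebras (table_space n) (g_bracket n) (table_space n) (L2_bracket n)"
    unfolding isomorphic_algebras_def
    by (rule exI[of _ id]) (auto simp: linear_iff g_bracket_eq_L2_bracket)
qed (use n in \<open>simp_all add: g_right_leibniz dim_table_space g_indecomposable g_nilradical\<close>)

section \<open>Extensions of L2 with a triangular basis of the nilradical\<close>

lemma product_space_cong:
  assumes "\<And>x y. x \<in> A \<Longrightarrow> y \<in> B \<Longrightarrow> br x y = br' x y"
  shows "product_space br A B = product_space br' A B"
proof -
  have "{br x y | x y. x \<in> A \<and> y \<in> B} = {br' x y | x y. x \<in> A \<and> y \<in> B}"
    using assms by force
  then show ?thesis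
    by (simp add: product_space_def)
qed

text \<open>The given bracket will be replaced by a total bilinear one that agrees with it only on
  \<open>V\<close>; this transfers solvability and nilpotency.\<close>

lemma series_cong:
  assumes "subspace M" and "\<And>x y. x \<in> M \<Longrightarrow> y \<in> M \<Longrightarrow> br x y \<in> M"
    and eq: "\<And>x y. x \<in> M \<Longrightarrow> y \<in> M \<Longrightarrow> br x y = br' x y"
  shows "lower_central M br k = lower_central M br' k" "derived_series M br k = derived_series M br' k"
proof -
  have P: "product_space br A B \<subseteq> M" if "A \<subseteq> M" "B \<subseteq> M" for A B
    using that assms(2) by (intro product_space_subset[OF _ assms(1)]) blast
  have "lower_central M br k = lower_central M br' k \<and> lower_central M br k \<subseteq> M"
  proof (induction k)
    case (Suc k)
    then have "product_space br (lower_central M br k) M = product_space br' (lower_central M br' k) M"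
      using eq by (auto intro!: product_space_cong)
    moreover have "product_space br (lower_central M br k) M \<subseteq> M"
      using Suc P by blast
    ultimately show ?case using Suc by simp
  qed simp
  then show "lower_central M br k = lower_central M br' k" by simp
  have "derived_series M br k = derived_series M br' k \<and> derived_series M br k \<subseteq> M"
  proof (induction k)
    case (Suc k)
    then have "product_space br (derived_series M br k) (derived_series M br k) = product_space br' (derived_series M br' k) (derived_series M br' k)"
      using eq by (auto intro!: product_space_cong)
    moreover have "product_space br (derived_series M br k) (derived_series M br k) \<subseteq> M"
      using Suc P by blast
    ultimately show ?case using Suc by simp
  qed simp
  then show "derived_series M br k = derived_series M br' k" by simp
qed

text \<open>Positivity of \<open>dim V\<close> excludes infinite bases, since \<open>card\<close> of
  an infinite set is 0.\<close>

lemma independent_card_eq_dim_spans: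
  fixes B :: "'a::real_vector set"
  assumes B: "independent B" "B \<subseteq> V" and card: "card B = dim V" and pos: "dim V > 0"
  shows "V \<subseteq> span B"
proof
  fix v assume v: "v \<in> V"
  show "v \<in> span B"
  proof (rule ccontr)
    assume nv: "v \<notin> span B"
    then have ind: "independent (insert v B)"
      using B(1) by (rule independent_insertI)
    obtain C where C: "insert v B \<subseteq> C" "C \<subseteq> V" "independent C" "V \<subseteq> span C"
      using maximal_independent_subset_extend[OF insert_subset[THEN iffD2, OF conjI[OF v B(2)]] ind] .
    have cC: "card C = dim V"
      by (rule basis_card_eq_dim[OF C(2,4,3)])
    then have "finite C" using pos card.infinite by fastforce
    then have "finite B" "card (insert v B) \<le> card C"
      using C(1) finite_subset[of B C] card_mono[of C "insert v B"] by auto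
    moreover have "v \<notin> B" using nv span_base by auto
    ultimately show False
      using cC card by simp
  qed
qed

lemma spanning_family_independent:
  fixes E :: "'i \<Rightarrow> 'a::real_vector"
  assumes I: "finite I" and E: "E ` I \<subseteq> V" "V \<subseteq> span (E ` I)" and card: "card I \<le> dim V"
  shows "inj_on E I \<and> independent (E ` I)"
proof -
  obtain C where C: "C \<subseteq> E ` I" "independent C" "E ` I \<subseteq> span C"
    using maximal_independent_subset by blast
  have "V \<subseteq> span C"
    using E(2) span_mono[OF C(3)] unfolding span_span by (rule order_trans)
  then have dC: "card C = dim V"
    using C(1,2) E(1) by (intro basis_card_eq_dim) auto
  have fin: "finite (E ` I)" using I by simp
  have "card C \<le> card (E ` I)" "card (E ` I) \<le> card I"
    using C fin I by (auto intro: card_mono card_image_le)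
  then have "card C = card (E ` I)" "card (E ` I) = card I"
    using dC card by linarith+
  then show ?thesis
    using C(2) card_subset_eq[OF fin C(1)] eq_card_imp_inj_on[OF I] by simp
qed

text \<open>\<open>br\<close> is bilinear on the whole type, so no membership conditions arise;
  \<open>b i\<close> is zero from \<open>n\<close> on, so the chain relations need no upper bound;
  the \<open>p i\<close> with \<open>i < n\<close> are the dual functionals.\<close>

locale L2_extension =
  fixes n :: nat and V :: "'a::real_vector set" and br :: "'a \<Rightarrow> 'a \<Rightarrow> 'a"
    and b :: "nat \<Rightarrow> 'a" and p :: "nat \<Rightarrow> 'a \<Rightarrow> real"
  assumes n4: "n \<ge> 4"
    and subspace_V: "subspace V"
    and bilinear: "bilinear br"
    and br_in_V: "br x y \<in> V"
    and leibniz: "br (br x y) z = br (br x z) y + br x (br y z)"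
    and linear_p: "linear (p i)"
    and p_b: "i < n \<Longrightarrow> p i (b j) = (if i = j then 1 else 0)"
    and b_ge: "i \<ge> n \<Longrightarrow> b i = 0"
    and b_in_V: "b i \<in> V"
    and br00: "br (b 0) (b 0) = 0"
    and br10: "br (b 1) (b 0) = b 3"
    and br01: "br (b 0) (b 1) = b 2 - b 3"
    and br20: "br (b 2) (b 0) = 0"
    and br02: "br (b 0) (b 2) = 0"
    and bri0: "i \<ge> 3 \<Longrightarrow> br (b i) (b 0) = b (Suc i)"
    and br0i: "i \<ge> 3 \<Longrightarrow> br (b 0) (b i) = - b (Suc i)"
    and brij: "i \<ge> 1 \<Longrightarrow> j \<ge> 1 \<Longrightarrow> br (b i) (b j) = 0"
    and ideal_left: "x \<in> span (range b) \<Longrightarrow> br x y \<in> span (range b)"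
    and ideal_right: "x \<in> span (range b) \<Longrightarrow> br y x \<in> span (range b)"
begin

lemmas br_simps = bilinear_ladd[OF bilinear] bilinear_radd[OF bilinear] bilinear_lmul[OF bilinear]
  bilinear_rmul[OF bilinear] bilinear_lsub[OF bilinear] bilinear_rsub[OF bilinear] bilinear_lneg[OF bilinear]
  bilinear_rneg[OF bilinear] bilinear_lzero[OF bilinear] bilinear_rzero[OF bilinear]

lemmas p_simps = linear_add[OF linear_p] linear_diff[OF linear_p] linear_cmul[OF linear_p]
  linear_neg[OF linear_p] linear_0[OF linear_p]

section \<open>The flag of the nilradical and operators triangular with respect to it\<close>

definition F :: "nat \<Rightarrow> 'a set" where
  "F i = span (b ` {i..})"

lemma F_0: "F 0 = span (range b)"
  by (simp add: F_def atLeast_0)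

lemma subspace_F: "subspace (F i)"
  by (simp add: F_def)

lemma F_antimono: "v \<in> F j \<Longrightarrow> i \<le> j \<Longrightarrow> v \<in> F i"
  unfolding F_def using span_mono[OF image_mono[of "{j..}" "{i..}" b]] by auto

lemma b_in_F: "i \<le> j \<Longrightarrow> b j \<in> F i"
  unfolding F_def by (intro span_base) auto

lemma F_ge: "F i = {0}" if "i \<ge> n"
proof -
  have "b ` {i..} = (\<lambda>_. 0) ` {i..}"
    using b_ge that by (intro image_cong) auto
  also have "\<dots> = {0}" by auto
  finally have "b ` {i..} = {0}" .
  then show ?thesis by (simp add: F_def)
qed

lemma F_subset_V: "F i \<subseteq> V"
  unfolding F_def using subspace_V b_in_V by (intro span_minimal) auto

lemma F_linear_image:
  assumes "v \<in> F i" and T: "linear T" and S: "subspace S" and "\<And>j. i \<le> j \<Longrightarrow> T (b j) \<in> S"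
  shows "T v \<in> S"
proof -
  have "subspace {v. T v \<in> S}"
    using S T by (auto simp: subspace_def linear_add linear_cmul linear_0)
  then have "F i \<subseteq> {v. T v \<in> S}"
    unfolding F_def using assms(4) by (intro span_minimal) auto
  with assms(1) show ?thesis by auto
qed

lemma linear_br: "linear (\<lambda>x. br x y)" "linear (\<lambda>y. br x y)"
  using bilinear by (auto simp: bilinear_def)

lemma p_F: "v \<in> F j \<Longrightarrow> i < j \<Longrightarrow> i < n \<Longrightarrow> p i v = 0"
  using F_linear_image[of v j "p i" "{0}"] by (auto simp: linear_p p_b subspace_def)

lemma F_step: "v - p i v *\<^sub>R b i \<in> F (Suc i)" if "v \<in> F i" "i < n"
proof (rule F_linear_image[OF that(1)])
  show "linear (\<lambda>v. v - p i v *\<^sub>R b i)"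
    by (auto simp: linear_iff p_simps algebra_simps)
  show "b j - p i (b j) *\<^sub>R b i \<in> F (Suc i)" if "i \<le> j" for j
    using that \<open>i < n\<close> by (auto simp: p_b b_in_F subspace_0[OF subspace_F] not_less_eq_eq dest: le_antisym)
qed (rule subspace_F)

lemma F_decomp:
  assumes "v \<in> F i" "i < n"
  obtains r where "r \<in> F (Suc i)" "v = p i v *\<^sub>R b i + r"
  using F_step[OF assms] by (metis add.commute diff_add_cancel)

lemma F_SucI: "v \<in> F i \<Longrightarrow> i < n \<Longrightarrow> p i v = 0 \<Longrightarrow> v \<in> F (Suc i)"
  using F_step[of v i] by simp

lemma F_intros: "u \<in> F i \<Longrightarrow> v \<in> F i \<Longrightarrow> u + v \<in> F i" "u \<in> F i \<Longrightarrow> v \<in> F i \<Longrightarrow> u - v \<in> F i"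
  "u \<in> F i \<Longrightarrow> c *\<^sub>R u \<in> F i" "0 \<in> F i" "u \<in> F i \<Longrightarrow> - u \<in> F i"
  using subspace_F by (auto intro: subspace_add subspace_diff subspace_scale subspace_0 subspace_neg)

lemma br_in_F_0: "x \<in> F i \<Longrightarrow> br x y \<in> F 0" "x \<in> F i \<Longrightarrow> br y x \<in> F 0"
  using ideal_left ideal_right F_antimono[of x i 0] by (simp_all add: F_0)

text \<open>\<open>T\<close> respects the flag and has diagonal \<open>w\<close>. It will be a right
  multiplication, possibly shifted by a scalar.\<close>

context
  fixes T :: "'a \<Rightarrow> 'a" and w :: "nat \<Rightarrow> real"
  assumes T: "linear T" and Tb: "\<And>i. T (b i) - w i *\<^sub>R b i \<in> F (Suc i)"
begin

lemma triangular_F: "T v \<in> F i" if "v \<in> F i"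
proof (rule F_linear_image[OF that T subspace_F])
  fix j assume "i \<le> j"
  then have "(T (b j) - w j *\<^sub>R b j) + w j *\<^sub>R b j \<in> F i"
    using F_antimono[OF Tb] by (intro F_intros(1,3) b_in_F) auto
  then show "T (b j) \<in> F i" by simp
qed

lemma triangular_p: "p i (T v) = w i * p i v" if v: "v \<in> F i" and i: "i < n"
proof -
  obtain r where r: "r \<in> F (Suc i)" "v = p i v *\<^sub>R b i + r"
    using F_decomp[OF v i] .
  have "T v - (w i * p i v) *\<^sub>R b i = p i v *\<^sub>R (T (b i) - w i *\<^sub>R b i) + T r"
    by (subst r(2)) (simp add: linear_add[OF T] linear_cmul[OF T] algebra_simps)
  also have "\<dots> \<in> F (Suc i)"
    using Tb r triangular_F by (intro F_intros(1)[OF F_intros(3)])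
  finally have "p i (T v - (w i * p i v) *\<^sub>R b i) = 0"
    using i p_F by blast
  then show ?thesis
    using i by (simp add: p_simps p_b)
qed

text \<open>The leading coefficient of a kernel vector is killed level by level until
  \<open>F n\<close>, which is zero. Only the diagonal from \<open>m\<close> on matters, so an
  eigenvalue can be excluded on a tail of the flag.\<close>

lemma triangular_inj: "v = 0"
  if "v \<in> F m" "T v = 0" and "\<And>i. m \<le> i \<Longrightarrow> i < n \<Longrightarrow> w i \<noteq> 0"
  using that
proof (induction "n - m" arbitrary: m)
  case 0
  then show ?case using F_ge[of m] by simp
next
  case (Suc k)
  then have m: "m < n" by simp
  have "w m * p m v = 0"
    using triangular_p[OF Suc.prems(1) m] Suc.prems(2) by (simp add: p_simps)
  then have "v \<in> F (Suc m)"
    using F_SucI Suc.prems m by auto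
  then show ?case
    using Suc.hyps m Suc.prems by (intro Suc.hyps(1)[of "Suc m"]) auto
qed

lemma triangular_surj: "\<exists>u\<in>F m. T u = v"
  if "v \<in> F m" and "\<And>i. m \<le> i \<Longrightarrow> i < n \<Longrightarrow> w i \<noteq> 0"
  using that
proof (induction "n - m" arbitrary: m v)
  case 0
  then show ?case using F_ge[of m] linear_0[OF T] by auto
next
  case (Suc k)
  then have m: "m < n" by simp
  obtain r where r: "r \<in> F (Suc m)" "v = p m v *\<^sub>R b m + r"
    using F_decomp[OF Suc.prems(1) m] .
  \<comment> \<open>\<open>c\<close> matches the leading coefficient; the remainder
    \<open>r'\<close> lies one level deeper and is solved by induction.\<close>
  define c where "c = p m v / w m"
  have "w m \<noteq> 0" using Suc.prems(2) m by simp
  then have c: "c * w m = p m v" by (simp add: c_def)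
  define r' where "r' = r - c *\<^sub>R (T (b m) - w m *\<^sub>R b m)"
  have "r' \<in> F (Suc m)"
    unfolding r'_def by (rule F_intros(2)[OF r(1) F_intros(3)[OF Tb]])
  then obtain u where u: "u \<in> F (Suc m)" "T u = r'"
    using Suc.hyps(1)[of "Suc m" r'] Suc.hyps(2) Suc.prems(2) m by fastforce
  have "T (c *\<^sub>R b m + u) = (c * w m) *\<^sub>R b m + r"
    by (simp add: linear_add[OF T] linear_cmul[OF T] u r'_def algebra_simps)
  then have "T (c *\<^sub>R b m + u) = v"
    using r(2) c by simp
  moreover have "c *\<^sub>R b m + u \<in> F m"
    using F_antimono[OF u(1)] by (intro F_intros(1,3) b_in_F) simp_all
  ultimately show ?case by blast
qed

end

lemma b_neq_0: "i < n \<Longrightarrow> b i \<noteq> 0"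
  using p_b[of i i] p_simps(5)[of i] by auto

text \<open>All pairs of basis vectors anticommute except \<open>b 0\<close> and \<open>b 1\<close>,
  whose symmetrized bracket is \<open>b 2\<close>.\<close>

lemma sym_bracket:
  assumes "u \<in> F 0" "v \<in> F 0"
  shows "br u v + br v u = (p 0 u * p 1 v + p 1 u * p 0 v) *\<^sub>R b 2"
proof (rule bilinear_eq[where f = "\<lambda>u v. br u v + br v u" and g = "\<lambda>u v. (p 0 u * p 1 v + p 1 u * p 0 v) *\<^sub>R b 2"
      and S = "F 0" and T = "F 0" and B = "range b" and C = "range b"])
  show "bilinear (\<lambda>u v. br u v + br v u)"
    by (simp add: bilinear_def linear_iff br_simps algebra_simps)
  show "bilinear (\<lambda>u v. (p 0 u * p 1 v + p 1 u * p 0 v) *\<^sub>R b 2)"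
    by (simp add: bilinear_def linear_iff p_simps algebra_simps)
next
  fix x y assume "x \<in> range b" "y \<in> range b"
  then obtain i j where ij: "x = b i" "y = b j" by blast
  have p: "p 0 (b i) = (if i = 0 then 1 else 0)" "p 1 (b i) = (if i = 1 then 1 else 0)" for i
    using n4 by (auto simp: p_b)
  have z: "br (b 0) (b i) + br (b i) (b 0) = (if i = 1 then b 2 else 0)" for i
  proof -
    consider "i = 0" | "i = 1" | "i = 2" | "i \<ge> 3" by linarith
    then show ?thesis
      by cases (auto simp: br00 br01[simplified] br10[simplified] br20 br02 br0i bri0)
  qed
  show "br x y + br y x = (p 0 x * p 1 y + p 1 x * p 0 y) *\<^sub>R b 2"
    using z[of i] z[of j] unfolding ij by (auto simp only: p) (auto simp: brij add.commute br00)
qed (use assms F_0 in auto)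

lemma br_F_1_F_1: "br u v = 0" if "u \<in> F 1" "v \<in> F 1"
  by (rule bilinear_eq[OF bilinear, of "\<lambda>_ _. 0" "F 1" "b ` {1..}" "F 1" "b ` {1..}"])
    (use that in \<open>auto simp: F_def brij bilinear_def linear_iff\<close>)

text \<open>\<open>b 0\<close> kills \<open>b 2\<close> and moves \<open>b 3\<close> to
  \<open>b 4\<close>, so two levels are gained from \<open>F 2\<close> and one level from deeper
  ones.\<close>

lemma br_b0_F:
  assumes "v \<in> F i" "i \<ge> 2"
  shows "br v (b 0) \<in> F (if i = 2 then 4 else Suc i)"
proof (rule F_linear_image[OF assms(1) linear_br(1) subspace_F])
  fix j assume j: "i \<le> j"
  show "br (b j) (b 0) \<in> F (if i = 2 then 4 else Suc i)"
  proof (cases "j = 2")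
    case True
    then show ?thesis by (simp add: br20 F_intros)
  next
    case False
    with assms j show ?thesis by (auto simp: bri0 intro!: b_in_F)
  qed
qed

lemma br_b0_F_left:
  assumes "v \<in> F 2"
  shows "br (b 0) v \<in> F 4"
proof -
  have "br v (b 0) + br (b 0) v = 0"
    using n4 F_antimono[OF assms, of 0] by (subst sym_bracket) (simp_all add: p_F[OF assms] b_in_F)
  then have "br (b 0) v = - br v (b 0)"
    by (simp add: eq_neg_iff_add_eq_0 add.commute)
  then show ?thesis
    using br_b0_F[OF assms] by (simp add: F_intros)
qed

section \<open>Weights: the diagonal of right multiplications on the nilradical\<close>

definition a :: "'a \<Rightarrow> real" where "a x = p 0 (br (b 0) x)"
definition d :: "'a \<Rightarrow> real" where "d x = p 1 (br (b 1) x)"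

lemma linear_ad: "linear a" "linear d"
  by (simp_all add: linear_iff a_def d_def br_simps p_simps)

lemmas ad_simps = linear_add[OF linear_ad(1)] linear_add[OF linear_ad(2)] linear_diff[OF linear_ad(1)] linear_diff[OF linear_ad(2)]
  linear_cmul[OF linear_ad(1)] linear_cmul[OF linear_ad(2)] linear_0[OF linear_ad(1)] linear_0[OF linear_ad(2)]

text \<open>Weights add under brackets: \<open>b 2\<close> and \<open>b 3\<close> arise from one
  bracket of \<open>b 0\<close> with \<open>b 1\<close>, and each further step of the chain brackets
  with \<open>b 0\<close> once more.\<close>

definition w :: "'a \<Rightarrow> nat \<Rightarrow> real" where
  "w x i = (if i = 0 then a x else if i = 1 then d x else if i = 2 then a x + d x
    else d x + (real i - 2) * a x)"

text \<open>The derivation applied to \<open>[b 0, b 0] = 0\<close> gives a vanishing symmetrized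
  bracket of \<open>b 0\<close> with \<open>[b 0, x]\<close>; its value is the \<open>b 1\<close>
  coordinate of \<open>[b 0, x]\<close> times \<open>b 2\<close>.\<close>

lemma right_mult_b0: "br (b 0) x - a x *\<^sub>R b 0 \<in> F 2"
proof -
  let ?u = "br (b 0) x"
  have u: "?u \<in> F 0" using br_in_F_0 b_in_F by blast
  have "br ?u (b 0) + br (b 0) ?u = 0"
    using leibniz[of "b 0" "b 0" x] by (simp add: br00 br_simps)
  moreover have "br ?u (b 0) + br (b 0) ?u = p 1 ?u *\<^sub>R b 2"
    using n4 by (subst sym_bracket) (auto simp: u b_in_F p_b)
  ultimately have "p 1 ?u = 0"
    using b_neq_0[of 2] n4 by simp
  moreover have "?u - a x *\<^sub>R b 0 \<in> F 1"
    unfolding a_def using F_step[OF u] n4 by simp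
  ultimately show ?thesis
    using F_SucI[of "?u - a x *\<^sub>R b 0" 1] n4 by (simp add: p_simps p_b numeral_2_eq_2)
qed

lemma right_mult_b1: "br (b 1) x - d x *\<^sub>R b 1 \<in> F 2"
proof -
  let ?u = "br (b 1) x"
  have u: "?u \<in> F 0" using br_in_F_0 b_in_F by blast
  have "br ?u (b 1) + br (b 1) ?u = 0"
    using leibniz[of "b 1" "b 1" x] by (simp add: brij br_simps)
  moreover have "br ?u (b 1) + br (b 1) ?u = p 0 ?u *\<^sub>R b 2"
    using n4 u[simplified] by (subst sym_bracket) (auto simp: b_in_F p_b)
  ultimately have "p 0 ?u = 0"
    using b_neq_0[of 2] n4 by simp
  then have "?u \<in> F 1"
    using F_SucI[OF u] n4 by simp
  then show ?thesis
    unfolding d_def using F_step[of ?u 1] n4 by (simp add: numeral_2_eq_2)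
qed

text \<open>\<open>b 2\<close> is a symmetrized bracket, so its image is a sum of two of them: an
  exact eigenvector, not only one modulo deeper levels.\<close>

lemma right_mult_b2: "br (b 2) x = (a x + d x) *\<^sub>R b 2"
proof -
  let ?u = "br (b 0) x" and ?v = "br (b 1) x"
  have uv: "?u \<in> F 0" "?v \<in> F 0" using br_in_F_0 b_in_F by blast+
  have "b 2 = br (b 0) (b 1) + br (b 1) (b 0)"
    by (simp add: br01[simplified] br10[simplified])
  then have "br (b 2) x = (br ?u (b 1) + br (b 1) ?u) + (br ?v (b 0) + br (b 0) ?v)"
    using leibniz[of "b 0" "b 1" x] leibniz[of "b 1" "b 0" x] by (simp add: br_simps)
  also have "\<dots> = (a x + d x) *\<^sub>R b 2"
    using n4 uv uv[simplified] by (simp only: sym_bracket b_in_F le0) (simp add: p_b a_def d_def algebra_simps)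
  finally show ?thesis .
qed

text \<open>Along the chain, apply the derivation to \<open>b (Suc i) = [b i, b 0]\<close>. The
  error in \<open>[b i, x]\<close> is pushed deeper by \<open>b 0\<close>; the error in
  \<open>[b 0, x]\<close> lies in the abelian \<open>F 1\<close> and contributes nothing.\<close>

lemma right_mult_b: "br (b i) x - w x i *\<^sub>R b i \<in> F (Suc i)"
proof -
  have ge3: "br (b (3 + k)) x - (d x + (real k + 1) * a x) *\<^sub>R b (3 + k) \<in> F (Suc (3 + k))" for k
  proof (induction k)
    case 0
    let ?u = "br (b 0) x - a x *\<^sub>R b 0" and ?v = "br (b 1) x - d x *\<^sub>R b 1"
    have "br (b 3) x = br (br (b 1) x) (b 0) + br (b 1) (br (b 0) x)"
      using leibniz[of "b 1" "b 0" x] by (simp add: br10[simplified])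
    also have "\<dots> = (d x + a x) *\<^sub>R b 3 + br ?v (b 0) + br (b 1) ?u"
      by (simp add: br_simps br10[simplified] algebra_simps)
    also have "br (b 1) ?u = 0"
      using F_antimono[OF right_mult_b0, of 1 x] by (intro br_F_1_F_1 b_in_F) simp_all
    finally have "br (b 3) x - (d x + a x) *\<^sub>R b 3 = br ?v (b 0)" by simp
    also have "\<dots> \<in> F 4"
      using br_b0_F[OF right_mult_b1] by simp
    finally show ?case by simp
  next
    case (Suc k)
    let ?i = "3 + k"
    let ?u = "br (b 0) x - a x *\<^sub>R b 0" and ?v = "br (b ?i) x - (d x + (real k + 1) * a x) *\<^sub>R b ?i"
    have "br (b (Suc ?i)) x = br (br (b ?i) x) (b 0) + br (b ?i) (br (b 0) x)"
      using leibniz[of "b ?i" "b 0" x] by (simp add: bri0)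
    also have "\<dots> = ((d x + (real k + 1) * a x) + a x) *\<^sub>R b (Suc ?i) + br ?v (b 0) + br (b ?i) ?u"
      unfolding br_simps scaleR_add_left by (simp add: bri0)
    also have "(d x + (real k + 1) * a x) + a x = d x + (real k + 2) * a x"
      by (simp add: algebra_simps)
    also have "br (b ?i) ?u = 0"
      using F_antimono[OF right_mult_b0, of 1 x] by (intro br_F_1_F_1 b_in_F) simp_all
    finally have "br (b (Suc ?i)) x - (d x + (real k + 2) * a x) *\<^sub>R b (Suc ?i) = br ?v (b 0)" by simp
    also have "\<dots> \<in> F (Suc (Suc ?i))"
      using br_b0_F[OF Suc.IH] by simp
    finally show ?case by (simp add: algebra_simps)
  qed
  consider "i = 0" | "i = 1" | "i = 2" | "i \<ge> 3" by linarith
  then show ?thesis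
  proof cases
    case 1
    then show ?thesis using F_antimono[OF right_mult_b0, of 1 x] by (simp add: w_def)
  next
    case 2
    then show ?thesis using right_mult_b1[of x] by (auto simp: w_def numeral_2_eq_2)
  next
    case 3
    then show ?thesis by (simp add: w_def right_mult_b2 F_intros)
  next
    case 4
    then obtain k where "i = 3 + k" using le_Suc_ex by blast
    then show ?thesis using ge3[of k] by (simp add: w_def algebra_simps)
  qed
qed

lemma right_mult_F: "v \<in> F i \<Longrightarrow> br v x \<in> F i"
  by (rule triangular_F[where T = "\<lambda>v. br v x" and w = "w x"]) (auto simp: linear_br right_mult_b)

lemma right_mult_p: "v \<in> F i \<Longrightarrow> i < n \<Longrightarrow> p i (br v x) = w x i * p i v"
  by (rule triangular_p[where T = "\<lambda>v. br v x" and w = "w x"]) (auto simp: linear_br right_mult_b)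

lemma eigenspace_trivial:
  assumes "v \<in> F m" "br v x = c *\<^sub>R v" "\<And>i. m \<le> i \<Longrightarrow> i < n \<Longrightarrow> w x i \<noteq> c"
  shows "v = 0"
proof (rule triangular_inj[where T = "\<lambda>v. br v x - c *\<^sub>R v" and w = "\<lambda>i. w x i - c"])
  show "br (b i) x - c *\<^sub>R b i - (w x i - c) *\<^sub>R b i \<in> F (Suc i)" for i
    using right_mult_b[of i x] by (simp add: algebra_simps)
qed (use assms in \<open>auto simp: linear_iff br_simps algebra_simps\<close>)

lemma right_mult_shift_surj:
  assumes "v \<in> F m" "\<And>i. m \<le> i \<Longrightarrow> i < n \<Longrightarrow> w x i \<noteq> c"
  obtains u where "u \<in> F m" "br u x - c *\<^sub>R u = v"
proof -
  have "\<exists>u\<in>F m. br u x - c *\<^sub>R u = v"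
  proof (rule triangular_surj[where T = "\<lambda>v. br v x - c *\<^sub>R v" and w = "\<lambda>i. w x i - c"])
    show "br (b i) x - c *\<^sub>R b i - (w x i - c) *\<^sub>R b i \<in> F (Suc i)" for i
      using right_mult_b[of i x] by (simp add: algebra_simps)
  qed (use assms in \<open>auto simp: linear_iff br_simps algebra_simps\<close>)
  then show thesis using that by blast
qed

lemma ad_F_0: "a y = 0" "d y = 0" if "y \<in> F 0"
proof -
  have "a (b j) = 0 \<and> d (b j) = 0" for j
  proof -
    consider "j = 0" | "j = 1" | "j = 2" | "j \<ge> 3" by linarith
    then show ?thesis
      using n4 by cases (auto simp: a_def d_def br00 br10[simplified] br01[simplified] br02 br0i brij[simplified] p_simps p_b)
  qed
  then show "a y = 0" "d y = 0"
    using F_linear_image[OF that, of a "{0}"] F_linear_image[OF that, of d "{0}"] by (auto simp: linear_ad subspace_def)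
qed

text \<open>Right multiplication by \<open>[x, y]\<close> is a commutator of triangular operators,
  so its diagonal vanishes.\<close>

lemma ad_br: "a (br x y) = 0" "d (br x y) = 0"
proof -
  have eq: "br v (br x y) = br (br v x) y - br (br v y) x" for v
    using leibniz[of v x y] by simp
  have b0: "br (b 0) z \<in> F 0" for z using right_mult_F b_in_F by blast
  have b1: "br (b 1) z \<in> F 1" for z using right_mult_F b_in_F by blast
  show "a (br x y) = 0"
    using n4 b0 by (simp add: a_def eq p_simps right_mult_p w_def)
  show "d (br x y) = 0"
    using n4 b1 by (simp add: d_def eq p_simps right_mult_p w_def)
qed

end

section \<open>The weights and the abelian complement\<close>

locale L2_nilradical_extension = L2_extension +
  assumes dim_V: "dim V = n + 2"
    and solvable: "solvable_algebra V br"
    and maximal: "two_sided_ideal V br M \<Longrightarrow> nilpotent_algebra M br \<Longrightarrow> F 0 \<subseteq> M \<Longrightarrow> M = F 0"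
begin

lemma F_0_eq: "F 0 = span (b ` {..<n})"
proof -
  have "b i \<in> span (b ` {..<n})" for i
    using b_ge[of i] by (cases "i < n") (auto intro: span_base span_zero)
  then have "F 0 \<subseteq> span (b ` {..<n})"
    unfolding F_0 by (intro span_minimal) auto
  moreover have "span (b ` {..<n}) \<subseteq> F 0"
    unfolding F_0 by (intro span_mono) auto
  ultimately show ?thesis by blast
qed

lemma inj_b: "inj_on b {..<n}"
proof (rule inj_onI)
  fix i j assume "i \<in> {..<n}" "j \<in> {..<n}" "b i = b j"
  then show "i = j" using p_b[of i i] p_b[of i j] by (auto split: if_splits)
qed

lemma independent_b: "independent (b ` {..<n})"
proof
  assume "dependent (b ` {..<n})"
  then obtain i where i: "i < n" "b i \<in> span (b ` {..<n} - {b i})"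
    by (auto simp: dependent_def)
  have "span (b ` {..<n} - {b i}) \<subseteq> {v. p i v = 0}"
  proof (rule span_minimal)
    show "subspace {v. p i v = 0}"
      by (auto simp: subspace_def p_simps)
    show "b ` {..<n} - {b i} \<subseteq> {v. p i v = 0}"
      using i by (auto simp: p_b)
  qed
  with i show False by (auto simp: p_b)
qed

lemma insert_insert_spans:
  assumes "x \<in> V" "y \<in> V" "x \<notin> F 0" "y \<notin> span (insert x (F 0))"
  shows "V \<subseteq> span (insert y (insert x (F 0)))"
proof -
  let ?B = "b ` {..<n}"
  have sp: "span (insert x (F 0)) = span (insert x ?B)" "span (insert y (insert x (F 0))) = span (insert y (insert x ?B))"
    unfolding F_0_eq by (simp_all only: span_insert span_span)
  have x: "x \<notin> span ?B" and y: "y \<notin> span (insert x ?B)"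
    using assms(3,4) unfolding sp by (simp_all add: F_0_eq)
  then have "independent (insert y (insert x ?B))"
    using independent_b by (intro independent_insertI)
  moreover have "card (insert y (insert x ?B)) = dim V"
  proof -
    have "x \<notin> ?B" "y \<notin> insert x ?B"
      using x y by (auto intro: span_base)
    then show ?thesis
      using inj_b by (simp add: card_image dim_V)
  qed
  moreover have "insert y (insert x ?B) \<subseteq> V"
    using assms b_in_V by auto
  ultimately have "V \<subseteq> span (insert y (insert x ?B))"
    using dim_V by (intro independent_card_eq_dim_spans) auto
  then show ?thesis unfolding sp .
qed

lemma span_insert_F: "v \<in> span (insert x (F 0)) \<longleftrightarrow> (\<exists>k. v - k *\<^sub>R x \<in> F 0)"
  by (simp add: span_insert F_0 span_span)

lemma V_not_subset: "\<not> V \<subseteq> span (insert x (F 0))"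
proof
  assume *: "V \<subseteq> span (insert x (F 0))"
  have "span (insert x (F 0)) = span (insert x (b ` {..<n}))"
    unfolding F_0_eq by (simp only: span_insert span_span)
  then have "dim V \<le> card (insert x (b ` {..<n}))"
    using * by (intro dim_le_card) auto
  also have "\<dots> \<le> Suc (card {..<n})"
    using card_image_le[of "{..<n}" b] by (simp add: card_insert_if)
  finally show False using dim_V by simp
qed

text \<open>\<open>F 0\<close> is an ideal: if the quotient by it is perfect, every term of the
  derived series still covers it, which solvability forbids for a nonzero quotient.\<close>

lemma derived_complement:
  assumes "\<And>v. v \<in> V \<Longrightarrow> \<exists>u\<in>product_space br V V. v - u \<in> F 0"
  shows "v \<in> V \<Longrightarrow> \<exists>u\<in>derived_series V br k. v - u \<in> F 0"
proof (induction k arbitrary: v)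
  case 0
  then show ?case by (auto simp: F_intros intro!: bexI[of _ v])
next
  case (Suc k)
  let ?D = "product_space br (derived_series V br k) (derived_series V br k)"
  have "product_space br V V \<subseteq> {v. \<exists>u\<in>?D. v - u \<in> F 0}"
  proof (rule product_space_subset)
    fix x y assume "x \<in> V" "y \<in> V"
    then obtain u v where uv: "u \<in> derived_series V br k" "x - u \<in> F 0" "v \<in> derived_series V br k" "y - v \<in> F 0"
      using Suc.IH by meson
    have "br x y - br u v = br (x - u) y + br u (y - v)"
      by (simp add: br_simps)
    also have "\<dots> \<in> F 0"
      using br_in_F_0[OF uv(2)] br_in_F_0[OF uv(4)] by (intro F_intros(1))
    finally show "br x y \<in> {v. \<exists>u\<in>?D. v - u \<in> F 0}"
      using br_in_product_space[OF uv(1,3)] by auto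
  next
    have "\<exists>u\<in>?D. x + y - u \<in> F 0" if "u \<in> ?D" "x - u \<in> F 0" "v \<in> ?D" "y - v \<in> F 0" for x y u v
      using subspace_add[OF subspace_product_space that(1,3)] F_intros(1)[OF that(2,4)]
      by (auto simp: algebra_simps intro!: bexI[of _ "u + v"])
    moreover have "\<exists>u\<in>?D. c *\<^sub>R x - u \<in> F 0" if "u \<in> ?D" "x - u \<in> F 0" for x u c
      using subspace_scale[OF subspace_product_space that(1), of c] F_intros(3)[OF that(2), of c]
      by (auto simp: algebra_simps intro!: bexI[of _ "c *\<^sub>R u"])
    moreover have "\<exists>u\<in>?D. 0 - u \<in> F 0"
      using subspace_0[OF subspace_product_space] by (auto simp: F_intros intro!: bexI[of _ 0])
    ultimately show "subspace {v. \<exists>u\<in>?D. v - u \<in> F 0}"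
      unfolding subspace_def by blast
  qed
  moreover obtain u where "u \<in> product_space br V V" "v - u \<in> F 0"
    using assms Suc.prems by blast
  ultimately obtain u' where "u' \<in> ?D" "u - u' \<in> F 0" by blast
  moreover have "(v - u) + (u - u') \<in> F 0"
    using \<open>v - u \<in> F 0\<close> \<open>u - u' \<in> F 0\<close> by (rule F_intros(1))
  ultimately show ?case by auto
qed

text \<open>If the weights of \<open>x\<close> vanish, then \<open>F 0\<close> together with a suitable such element spans a
  nilpotent ideal; solvability guarantees that the element can be chosen so that the span contains
  all brackets.\<close>

lemma weight_zero_in_F:
  assumes x: "x \<in> V" and ad: "a x = 0" "d x = 0"
  shows "x \<in> F 0"
proof (rule ccontr)
  assume xF: "x \<notin> F 0"
  \<comment> \<open>The span of \<open>x\<close> and \<open>F 0\<close> may fail to be an ideal. If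
    all brackets lie in \<open>F 0\<close>, \<open>x\<close> itself serves; otherwise a bracket
    outside \<open>F 0\<close> does, its weights being zero automatically.\<close>
  have "\<exists>y\<in>V. a y = 0 \<and> d y = 0 \<and> y \<notin> F 0 \<and> (\<forall>u\<in>V. \<forall>v\<in>V. br u v \<in> span (insert y (F 0)))"
  proof (cases "\<forall>u\<in>V. \<forall>v\<in>V. br u v \<in> F 0")
    case True
    then show ?thesis
      using x ad xF by (intro bexI[of _ x]) (auto intro!: span_base)
  next
    case False
    then obtain u v where uv: "u \<in> V" "v \<in> V" "br u v \<notin> F 0" by blast
    let ?y = "br u v"
    \<comment> \<open>A second bracket independent of \<open>?y\<close> modulo \<open>F 0\<close>
      would, in codimension two, fill the quotient.\<close>
    have "br u' v' \<in> span (insert ?y (F 0))" if "u' \<in> V" "v' \<in> V" for u' v'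
    proof (rule ccontr)
      let ?z = "br u' v'"
      assume "?z \<notin> span (insert ?y (F 0))"
      then have sp: "V \<subseteq> span (insert ?z (insert ?y (F 0)))"
        using br_in_V uv by (intro insert_insert_spans) auto
      have yz: "?y \<in> product_space br V V" "?z \<in> product_space br V V"
        using uv that by (simp_all add: br_in_product_space)
      have "\<exists>w\<in>product_space br V V. v - w \<in> F 0" if "v \<in> V" for v
      proof -
        obtain k l where "v - k *\<^sub>R ?z - l *\<^sub>R ?y \<in> F 0"
          using subsetD[OF sp \<open>v \<in> V\<close>] unfolding span_insert[of ?z] span_insert_F by blast
        then show ?thesis
          using yz by (intro bexI[of _ "k *\<^sub>R ?z + l *\<^sub>R ?y"] subspace_add subspace_scale subspace_product_space)
            (simp add: algebra_simps)
      qed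
      from derived_complement[OF this x] obtain w where "w \<in> {0}" "x - w \<in> F 0"
        using solvable unfolding solvable_algebra_def by metis
      with xF show False by simp
    qed
    then show ?thesis
      using uv br_in_V ad_br by (intro bexI[of _ ?y]) auto
  qed
  then obtain y where y: "y \<in> V" "a y = 0" "d y = 0" "y \<notin> F 0"
      "\<And>u v. u \<in> V \<Longrightarrow> v \<in> V \<Longrightarrow> br u v \<in> span (insert y (F 0))"
    by blast
  let ?M = "span (insert y (F 0))"
  have MV: "?M \<subseteq> V"
    using y(1) F_subset_V[of 0] subspace_V by (intro span_minimal) auto
  have ideal: "two_sided_ideal V br ?M"
    unfolding two_sided_ideal_def using MV y(5) by auto
  have w0: "w z i = 0" if z: "z \<in> ?M" for z i
  proof -
    obtain k where "z - k *\<^sub>R y \<in> F 0" using z span_insert_F by blast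
    then have "a (z - k *\<^sub>R y) = 0" "d (z - k *\<^sub>R y) = 0" using ad_F_0 by blast+
    then show ?thesis using y by (simp add: ad_simps w_def)
  qed
  have shift: "br v z \<in> F (Suc i)" if "v \<in> F i" "z \<in> ?M" for v z i
  proof (rule F_linear_image[OF that(1) linear_br(1) subspace_F])
    fix j assume "i \<le> j"
    moreover have "br (b j) z \<in> F (Suc j)"
      using right_mult_b[of j z] w0[OF that(2)] by simp
    ultimately show "br (b j) z \<in> F (Suc i)" using F_antimono by simp
  qed
  \<comment> \<open>With \<open>[y, y] = c y\<close> modulo \<open>F 0\<close>, the identity
    \<open>[y, [y, y]] = 0\<close> puts \<open>c [y, y]\<close> into \<open>F 0\<close>; either
    \<open>c\<close> is zero or it can be divided out.\<close>
  have yy: "br y y \<in> F 0"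
  proof -
    obtain c where c: "br y y - c *\<^sub>R y \<in> F 0"
      using y(5)[OF y(1) y(1)] span_insert_F by blast
    have "br y (br y y) = 0"
      using leibniz[of y y y] by simp
    moreover have "br y (br y y - c *\<^sub>R y) \<in> F 0"
      using c by (rule br_in_F_0)
    ultimately have "c *\<^sub>R br y y \<in> F 0"
      using F_intros(5) by (fastforce simp: br_simps)
    then show ?thesis
      using c F_intros(3)[of "c *\<^sub>R br y y" 0 "1 / c"] by (cases "c = 0") auto
  qed
  have MM: "br u v \<in> F 0" if "u \<in> ?M" "v \<in> ?M" for u v
  proof -
    obtain k l where kl: "u - k *\<^sub>R y \<in> F 0" "v - l *\<^sub>R y \<in> F 0"
      using \<open>u \<in> ?M\<close> \<open>v \<in> ?M\<close> span_insert_F by blast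
    have "br u v = br (u - k *\<^sub>R y) v + (k *\<^sub>R br y (v - l *\<^sub>R y) + (k * l) *\<^sub>R br y y)"
      by (simp add: br_simps algebra_simps)
    also have "\<dots> \<in> F 0"
      using kl yy br_in_F_0 by (intro F_intros(1) F_intros(3)) blast+
    finally show ?thesis .
  qed
  \<comment> \<open>The first bracket only leads into \<open>F 0\<close>; each later one descends a
    level.\<close>
  have "lower_central ?M br (Suc k) \<subseteq> F k" for k
  proof (induction k)
    case 0
    show ?case using product_space_subset[OF MM subspace_F] by simp
  next
    case (Suc k)
    show ?case
      by (subst lower_central.simps, rule product_space_subset[OF _ subspace_F]) (use Suc.IH shift in blast)
  qed
  from this[of n] have "lower_central ?M br (Suc n) \<subseteq> {0}"
    using F_ge[of n] by simp
  moreover have "0 \<in> lower_central ?M br (Suc n)"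
    using subspace_0[OF subspace_product_space] by simp
  ultimately have "nilpotent_algebra ?M br"
    unfolding nilpotent_algebra_def by blast
  from maximal[OF ideal this] have "?M = F 0"
    using span_superset[of "insert y (F 0)"] by auto
  then show False
    using y(4) span_base[of y "insert y (F 0)"] by auto
qed

lemma bracket_in_F: "br x y \<in> F 0"
  using weight_zero_in_F[OF br_in_V] ad_br by blast

text \<open>The pair of weights is injective on the two-dimensional quotient, hence onto; the
  preimage is given by Cramer's rule.\<close>

lemma weights_surj: "\<exists>x\<in>V. a x = \<alpha> \<and> d x = \<delta>"
proof -
  obtain x where x: "x \<in> V" "x \<notin> F 0"
    using V_not_subset[of 0] by (auto intro: span_base)
  obtain y where y: "y \<in> V" "y \<notin> span (insert x (F 0))"
    using V_not_subset by blast
  have comb: "s = 0 \<and> t = 0" if "s *\<^sub>R x + t *\<^sub>R y \<in> F 0" for s t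
  proof -
    have "t = 0"
    proof (rule ccontr)
      assume "t \<noteq> 0"
      have "(1 / t) *\<^sub>R (s *\<^sub>R x + t *\<^sub>R y) \<in> F 0"
        using that by (rule F_intros)
      also have "(1 / t) *\<^sub>R (s *\<^sub>R x + t *\<^sub>R y) = y - (- s / t) *\<^sub>R x"
        using \<open>t \<noteq> 0\<close> by (simp add: scaleR_add_right)
      finally show False using y(2) unfolding span_insert_F by blast
    qed
    moreover have "s = 0"
    proof (rule ccontr)
      assume "s \<noteq> 0"
      have "s *\<^sub>R x \<in> F 0"
        using that \<open>t = 0\<close> by simp
      then have "(1 / s) *\<^sub>R (s *\<^sub>R x) \<in> F 0"
        by (rule F_intros(3))
      then show False using x \<open>s \<noteq> 0\<close> by simp
    qed
    ultimately show ?thesis by simp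
  qed
  have V: "s *\<^sub>R x + t *\<^sub>R y \<in> V" for s t
    using x y subspace_V by (intro subspace_add subspace_scale)
  have nz: "s = 0 \<and> t = 0" if "s * a x + t * a y = 0" "s * d x + t * d y = 0" for s t
    using that by (intro comb weight_zero_in_F V) (simp_all add: ad_simps)
  define D where "D = a x * d y - a y * d x"
  have "D \<noteq> 0"
  proof
    assume D: "D = 0"
    \<comment> \<open>If the determinant vanishes, the cofactor combinations of \<open>x\<close> and
      \<open>y\<close> have weight zero, so all four weights are zero.\<close>
    have "a y = 0 \<and> - a x = 0"
      using D by (intro nz) (simp_all add: D_def algebra_simps)
    moreover have "d y = 0 \<and> - d x = 0"
      using D by (intro nz) (simp_all add: D_def algebra_simps)
    ultimately show False using nz[of 1 0] by simp
  qed
  let ?z = "((\<alpha> * d y - a y * \<delta>) / D) *\<^sub>R x + ((a x * \<delta> - \<alpha> * d x) / D) *\<^sub>R y"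
  have "a ?z = \<alpha>" "d ?z = \<delta>"
    using \<open>D \<noteq> 0\<close> by (simp_all add: ad_simps field_simps) (simp_all add: D_def algebra_simps)
  then show ?thesis using V by blast
qed

text \<open>The weights demanded are those of \<open>e (n + 1)\<close> and \<open>e (n + 2)\<close>
  in \<open>g\<close>. Corrections by \<open>F 0\<close> leave weights alone, so these can be fixed
  before passing to the kernel of right multiplication by \<open>h\<close>.\<close>

lemma torus:
  obtains A B where "A \<in> V" "B \<in> V" "a A = 1" "d A = - 1" "a B = 1" "d B = 0"
    "br A A = 0" "br A B = 0" "br B A = 0" "br B B = 0"
proof -
  obtain h where h: "h \<in> V" "a h = 1" "d h = 2" using weights_surj by blast
  have w: "w h i > 0" for i
    by (auto simp: w_def h)
  have corr: "\<exists>z'\<in>V. a z' = a z \<and> d z' = d z \<and> br z' h = 0" if z: "z \<in> V" for z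
  proof -
    obtain u where u: "u \<in> F 0" "br u h - 0 *\<^sub>R u = br z h"
      using right_mult_shift_surj[OF bracket_in_F, where x = h and c = 0] w by (metis less_irrefl)
    then have "br (z - u) h = 0" by (simp add: br_simps)
    moreover have "z - u \<in> V"
      using z u F_subset_V subspace_V by (auto intro: subspace_diff)
    ultimately show ?thesis
      using ad_F_0[OF u(1)] by (intro bexI[of _ "z - u"]) (simp_all add: ad_simps)
  qed
  obtain A where A: "A \<in> V" "a A = 1" "d A = - 1" "br A h = 0"
    using weights_surj corr by metis
  obtain B where B: "B \<in> V" "a B = 1" "d B = 0" "br B h = 0"
    using weights_surj corr by metis
  have com: "br X Y = 0" if "br X h = 0" "br Y h = 0" for X Y
  proof (rule eigenspace_trivial[OF bracket_in_F, where x = h and c = 0])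
    show "br (br X Y) h = 0 *\<^sub>R br X Y"
      using leibniz[of X Y h] that by (simp add: br_simps)
  qed (use w in \<open>metis less_irrefl\<close>)
  show thesis
    using that[of A B] A B com by simp
qed

end

section \<open>The eigenbasis and its multiplication table\<close>

locale L2_eigenbasis = L2_extension +
  fixes h f0 f1
  assumes a_h: "a h = 1" and d_h: "d h = 2"
    and f0: "b 0 - f0 \<in> F 2" "br f0 h = f0"
    and f1: "b 1 - f1 \<in> F 2" "br f1 h = 2 *\<^sub>R f1"
begin

lemma eigenspace_1: "v \<in> F 1 \<Longrightarrow> br v h = v \<Longrightarrow> v = 0"
  by (rule eigenspace_trivial[where x = h and c = 1 and m = 1]) (auto simp: w_def a_h d_h)

lemma eigenspace_2: "v \<in> F 2 \<Longrightarrow> br v h = 2 *\<^sub>R v \<Longrightarrow> v = 0"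
  by (rule eigenspace_trivial[where x = h and c = 2 and m = 2]) (auto simp: w_def a_h d_h)

text \<open>The chain generated from \<open>f1\<close> by \<open>f0\<close>; \<open>g k\<close>
  takes the place of \<open>b (3 + k)\<close>, that is of \<open>e (k + 4)\<close>.\<close>

definition g :: "nat \<Rightarrow> 'a" where
  "g k = ((\<lambda>v. br v f0) ^^ k) (br f1 f0)"

lemma g_0: "br f1 f0 = g 0"
  by (simp add: g_def)

lemma g_Suc: "br (g k) f0 = g (Suc k)"
  by (simp add: g_def)

lemma f0_in_F: "f0 \<in> F 0"
  using F_intros(2)[OF b_in_F[of 0 0] F_antimono[OF f0(1), of 0]] by simp

lemma f1_in_F: "f1 \<in> F 1"
  using F_intros(2)[OF b_in_F[of 1 1] F_antimono[OF f1(1), of 1]] by simp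

lemma p_f: "p 0 f0 = 1" "p 1 f0 = 0" "p 0 f1 = 0" "p 1 f1 = 1"
  using p_F[OF f0(1), of 0] p_F[OF f0(1), of 1] p_F[OF f1(1), of 0] p_F[OF f1(1), of 1] n4
  by (simp_all add: p_simps p_b)

lemma br_F_2_f0: "v \<in> F 2 \<Longrightarrow> br f0 v = - br v f0"
  using sym_bracket[of f0 v] F_antimono[of v 2 0] f0_in_F p_F[of v 2] n4
  by (simp add: p_f eq_neg_iff_add_eq_0)

text \<open>With \<open>f0 = b 0 - u\<close> the square splits into \<open>[u, u]\<close>, zero in
  the abelian \<open>F 1\<close>, and the symmetrized bracket of \<open>b 0\<close> with
  \<open>u\<close>, zero because \<open>u\<close> has no \<open>b 1\<close> coordinate.\<close>

lemma br_f0_f0: "br f0 f0 = 0"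
proof -
  let ?u = "b 0 - f0"
  have "br (b 0) ?u + br ?u (b 0) = 0"
    using n4 F_antimono[OF f0(1), of 0] p_F[OF f0(1)] by (subst sym_bracket) (simp_all add: b_in_F)
  moreover have "br ?u ?u = 0"
    using F_antimono[OF f0(1), of 1] by (intro br_F_1_F_1) simp_all
  moreover have "br f0 f0 = br ?u ?u - (br (b 0) ?u + br ?u (b 0))"
    by (simp add: br_simps br00)
  ultimately show ?thesis by simp
qed

lemma br_f0_f1: "br f0 f1 = b 2 - g 0"
  using sym_bracket[of f0 f1] f0_in_F F_antimono[OF f1_in_F, of 0] p_f
  by (simp add: g_0 eq_diff_eq)

lemma br_b2_f0: "br (b 2) f0 = 0"
proof -
  have "br (b 2) (b 0 - f0) = 0"
    using F_antimono[OF f0(1), of 1] by (intro br_F_1_F_1) (simp_all add: b_in_F)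
  then show ?thesis by (simp add: br_simps br20)
qed

lemma br_f0_b2: "br f0 (b 2) = 0"
  using br_F_2_f0[of "b 2"] by (simp add: b_in_F br_b2_f0)

lemma br_f0_F: "br v f0 - br v (b 0) = 0" if "v \<in> F 1"
proof -
  have "br v (b 0 - f0) = 0"
    using F_antimono[OF f0(1), of 1] that by (intro br_F_1_F_1) simp_all
  then show ?thesis by (simp add: br_simps)
qed

lemma g_minus_b: "g k - b (3 + k) \<in> F (4 + k)"
proof (induction k)
  case 0
  have "br f1 f0 = br f1 (b 0)"
    using br_f0_F[OF f1_in_F] by simp
  then have "g 0 - b 3 = - br (b 1 - f1) (b 0)"
    by (simp add: br_simps br10[simplified] g_0)
  also have "\<dots> \<in> F 4"
    using br_b0_F[OF f1(1)] by (intro F_intros(5)) simp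
  finally show ?case by simp
next
  case (Suc k)
  have "g k - b (3 + k) + b (3 + k) \<in> F 1"
    using F_antimono[OF Suc.IH, of 1] by (intro F_intros(1) b_in_F) simp_all
  then have "br (g k) f0 = br (g k) (b 0)"
    using br_f0_F by simp
  then have "g (Suc k) - b (3 + Suc k) = br (g k - b (3 + k)) (b 0)"
    by (simp add: br_simps bri0 g_Suc)
  also have "\<dots> \<in> F (4 + Suc k)"
    using br_b0_F[OF Suc.IH] by simp
  finally show ?case .
qed

lemma g_in_F: "g k \<in> F (3 + k)"
proof -
  have "g k - b (3 + k) + b (3 + k) \<in> F (3 + k)"
    using F_antimono[OF g_minus_b, of "3 + k" k] by (intro F_intros(1) b_in_F) simp_all
  then show ?thesis by simp
qed

lemma g_eq_0: "n \<le> 3 + k \<Longrightarrow> g k = 0"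
  using g_in_F[of k] F_ge[of "3 + k"] by simp

lemma in_F_1: "f1 \<in> F 1" "b 2 \<in> F 1" "g k \<in> F 1"
  using f1_in_F b_in_F[of 1 2] F_antimono[OF g_in_F, of 1 k] by simp_all

lemma br_f0_g: "br f0 (g k) = - g (Suc k)"
  using br_F_2_f0[of "g k"] F_antimono[OF g_in_F, of 2 k] by (simp add: g_Suc)

lemma F_0_subset_span: "F 0 \<subseteq> span ({f0, f1, b 2} \<union> range g)" (is "_ \<subseteq> ?S")
proof -
  \<comment> \<open>Downward along the flag: \<open>g k\<close> equals \<open>b (3 + k)\<close> up
    to deeper levels.\<close>
  have F3: "F (3 + k) \<subseteq> ?S" for k
  proof (induction "n - k" arbitrary: k)
    case 0
    then show ?case using F_ge[of "3 + k"] by (simp add: span_zero)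
  next
    case (Suc m)
    have IH: "F (4 + k) \<subseteq> ?S"
      using Suc.hyps(1)[of "Suc k"] Suc.hyps(2) by simp
    have "b j \<in> ?S" if "3 + k \<le> j" for j
    proof (cases "j = 3 + k")
      case True
      have "g k - (g k - b (3 + k)) \<in> ?S"
        by (rule span_diff[OF span_base subsetD[OF IH g_minus_b]]) simp
      then show ?thesis using True by simp
    next
      case False
      then show ?thesis using IH that b_in_F[of "4 + k" j] by auto
    qed
    then show ?case unfolding F_def by (intro span_minimal) auto
  qed
  have "b j \<in> ?S" if "2 \<le> j" for j
    using that F3[of 0] b_in_F[of 3 j] by (cases "j = 2") (auto intro: span_base)
  then have F2: "F 2 \<subseteq> ?S"
    unfolding F_def by (intro span_minimal) auto
  have "(b 0 - f0) + f0 \<in> ?S" "(b 1 - f1) + f1 \<in> ?S"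
    using F2 f0(1) f1(1) by (intro span_add; auto intro: span_base)+
  then have "b 0 \<in> ?S" "b 1 \<in> ?S" by simp_all
  moreover have "b j \<in> ?S" if "2 \<le> j" for j
    using F2 b_in_F[OF that] by blast
  ultimately have "b j \<in> ?S" for j
    by (metis One_nat_def Suc_1 less_2_cases not_le)
  then show ?thesis
    unfolding F_0 by (intro span_minimal) auto
qed

text \<open>Right multiplication by \<open>[x, y]\<close> is a commutator, so it changes sign when
  \<open>x\<close> and \<open>y\<close> are exchanged.\<close>

lemma br_sym_right: "br z (br x y + br y x) = 0"
proof -
  have "br z (br x y) = br (br z x) y - br (br z y) x" "br z (br y x) = br (br z y) x - br (br z x) y"
    subgoal using leibniz[of z x y] by simp
    subgoal using leibniz[of z y x] by simp
    done
  then show ?thesis unfolding br_simps by simp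
qed

lemma br_b2_right: "br z (b 2) = 0"
  using br_sym_right[of z f0 f1] by (simp add: br_f0_f1 g_0)

section \<open>The action of an element commuting with \<open>h\<close> on the eigenbasis\<close>

context
  fixes X
  assumes Xh: "br X h = 0"
begin

text \<open>Since \<open>[X, h] = 0\<close>, right multiplication by \<open>X\<close> preserves the
  eigenspaces of \<open>h\<close>. The difference of the two sides has eigenvalue 1 but lies in
  \<open>F 1\<close>, where 1 does not occur.\<close>

lemma br_f0_X: "br f0 X = a X *\<^sub>R f0"
proof -
  let ?u = "b 0 - f0"
  have "br f0 X - a X *\<^sub>R f0 = (br (b 0) X - a X *\<^sub>R b 0) - (br ?u X - a X *\<^sub>R ?u)"
    by (simp add: br_simps algebra_simps)
  also have "\<dots> \<in> F 2"
    by (intro F_intros(2,3) right_mult_b0 right_mult_F f0(1))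
  finally have "br f0 X - a X *\<^sub>R f0 \<in> F 1"
    by (rule F_antimono) simp
  moreover have "br (br f0 X - a X *\<^sub>R f0) h = br f0 X - a X *\<^sub>R f0"
    using leibniz[of f0 X h] by (simp add: br_simps Xh f0(2))
  ultimately show ?thesis
    using eigenspace_1 by fastforce
qed

lemma br_f1_X: "br f1 X = d X *\<^sub>R f1"
proof -
  let ?u = "b 1 - f1"
  have "br f1 X - d X *\<^sub>R f1 = (br (b 1) X - d X *\<^sub>R b 1) - (br ?u X - d X *\<^sub>R ?u)"
    by (simp add: br_simps algebra_simps)
  also have "\<dots> \<in> F 2"
    by (intro F_intros(2,3) right_mult_b1 right_mult_F f1(1))
  finally have "br f1 X - d X *\<^sub>R f1 \<in> F 2" .
  moreover have "br (br f1 X - d X *\<^sub>R f1) h = 2 *\<^sub>R (br f1 X - d X *\<^sub>R f1)"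
    using leibniz[of f1 X h] by (simp add: br_simps Xh f1(2) algebra_simps)
  ultimately show ?thesis
    using eigenspace_2 by fastforce
qed

text \<open>A symmetric bracket \<open>br x y + br y x\<close> is annihilated by all left multiplications; inside an
  eigenspace of right multiplication by \<open>h\<close> this forces it to vanish.\<close>

lemma sym_bracket_in_F_1:
  assumes "y = br u v + br v u" and "v \<in> F 0"
  shows "y \<in> F 1"
proof -
  have y: "y \<in> F 0"
    using assms br_in_F_0 by (auto intro: F_intros)
  then obtain r where r: "r \<in> F 1" "y = p 0 y *\<^sub>R b 0 + r"
    using F_decomp[of y 0] n4 by auto
  \<comment> \<open>Left multiplication by \<open>b 1\<close> sees exactly the \<open>b 0\<close>
    coordinate of \<open>y\<close>.\<close>
  have "br (b 1) y = 0"
    unfolding assms by (rule br_sym_right)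
  moreover have "br (b 1) y = p 0 y *\<^sub>R b 3"
    by (subst r(2)) (use br_F_1_F_1[OF b_in_F[of 1 1] r(1)] in \<open>simp add: br_simps br10[simplified]\<close>)
  ultimately have "p 0 y = 0"
    using b_neq_0[of 3] n4 by simp
  then show ?thesis using r by simp
qed

lemma br_X_f0: "br X f0 = - (a X *\<^sub>R f0)"
proof -
  let ?y = "br X f0 + br f0 X"
  have "br ?y h = ?y"
    using leibniz[of f0 X h] leibniz[of X f0 h] by (simp add: br_simps Xh f0(2))
  then have "?y = 0"
    using sym_bracket_in_F_1[OF refl f0_in_F] by (intro eigenspace_1)
  then show ?thesis by (simp add: br_f0_X eq_neg_iff_add_eq_0)
qed

lemma br_X_f1: "br X f1 = - (d X *\<^sub>R f1)"
proof -
  let ?y = "br X f1 + br f1 X"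
  have h: "br ?y h = 2 *\<^sub>R ?y"
    using leibniz[of f1 X h] leibniz[of X f1 h] by (simp add: br_simps Xh f1(2) algebra_simps)
  have y: "?y \<in> F 1"
    using sym_bracket_in_F_1[OF refl F_antimono[OF f1_in_F]] by simp
  obtain r where r: "r \<in> F 2" "?y = p 1 ?y *\<^sub>R b 1 + r"
    using F_decomp[OF y] n4 by (auto simp: numeral_2_eq_2)
  \<comment> \<open>The eigenvalue 2 still occurs on \<open>F 1\<close>, so the \<open>b 1\<close>
    coordinate must be removed too. Left multiplication by \<open>b 0\<close> sends
    \<open>F 2\<close> into \<open>F 4\<close>, so this coordinate can be read off at
    \<open>b 2\<close>.\<close>
  have "br (b 0) ?y = p 1 ?y *\<^sub>R (b 2 - b 3) + br (b 0) r"
    by (subst r(2)) (simp add: br_simps br01[simplified])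
  then have "p 1 ?y *\<^sub>R (b 2 - b 3) + br (b 0) r = 0"
    by (simp only: br_sym_right)
  then have "p 2 (p 1 ?y *\<^sub>R (b 2 - b 3) + br (b 0) r) = 0"
    by (simp only: p_simps)
  then have "p 1 ?y = 0"
    using p_F[OF br_b0_F_left[OF r(1)], of 2] n4 by (simp add: p_simps p_b)
  then have "?y \<in> F 2"
    using r by simp
  then have "?y = 0"
    using h by (rule eigenspace_2)
  then show ?thesis by (simp add: br_f1_X eq_neg_iff_add_eq_0)
qed

lemma br_g_X: "br (g k) X = (d X + (real k + 1) * a X) *\<^sub>R g k"
proof (induction k)
  case 0
  show ?case
    using leibniz[of f1 f0 X] by (simp add: g_0 br_f0_X br_f1_X br_simps scaleR_add_left)
next
  case (Suc k)
  have "br (g (Suc k)) X = br (br (g k) X) f0 + br (g k) (br f0 X)"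
    using leibniz[of "g k" f0 X] by (simp add: g_Suc)
  also have "\<dots> = (d X + (real k + 1) * a X) *\<^sub>R g (Suc k) + a X *\<^sub>R g (Suc k)"
    by (simp only: Suc.IH br_f0_X br_simps g_Suc)
  also have "\<dots> = (d X + (real k + 1) * a X + a X) *\<^sub>R g (Suc k)"
    by (simp only: scaleR_add_left)
  also have "d X + (real k + 1) * a X + a X = d X + (real (Suc k) + 1) * a X"
    by (simp add: algebra_simps)
  finally show ?case .
qed

text \<open>The term in \<open>b 2\<close> comes from \<open>[f0, f1] = b 2 - g 0\<close>.\<close>

lemma br_X_g_0: "br X (g 0) = a X *\<^sub>R b 2 - (a X + d X) *\<^sub>R g 0"
proof -
  have "br X (g 0) = br (br X f1) f0 - br (br X f0) f1"
    using leibniz[of X f1 f0] by (simp add: g_0)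
  then show ?thesis
    by (simp add: br_X_f0 br_X_f1 br_simps g_0 br_f0_f1 algebra_simps)
qed

text \<open>Right multiplication by \<open>f0\<close> kills the \<open>b 2\<close> term of
  \<open>br X (g 0)\<close>, so a uniform formula starts one step later.\<close>

lemma br_X_g_Suc: "br X (g (Suc k)) = - ((d X + (real k + 2) * a X) *\<^sub>R g (Suc k))"
proof (induction k)
  case 0
  have "br X (g (Suc 0)) = br (br X (g 0)) f0 - br (br X f0) (g 0)"
    using leibniz[of X "g 0" f0] by (simp add: g_Suc)
  also have "\<dots> = - ((a X + d X) *\<^sub>R g (Suc 0)) - a X *\<^sub>R g (Suc 0)"
    by (simp add: br_X_f0 br_X_g_0 br_simps g_Suc br_f0_g br_b2_f0)
  also have "\<dots> = - ((a X + d X + a X) *\<^sub>R g (Suc 0))"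
    by (simp only: scaleR_add_left minus_add_distrib) simp
  also have "a X + d X + a X = d X + (real 0 + 2) * a X"
    by simp
  finally show ?case .
next
  case (Suc k)
  let ?c = "d X + (real k + 2) * a X"
  have "br X (g (Suc (Suc k))) = br (br X (g (Suc k))) f0 - br (br X f0) (g (Suc k))"
    using leibniz[of X "g (Suc k)" f0] by (simp add: g_Suc)
  also have "\<dots> = - (?c *\<^sub>R g (Suc (Suc k))) - a X *\<^sub>R g (Suc (Suc k))"
    by (simp only: Suc.IH br_X_f0 br_simps g_Suc br_f0_g) simp
  also have "\<dots> = - ((?c + a X) *\<^sub>R g (Suc (Suc k)))"
    by (simp only: scaleR_add_left minus_add_distrib) simp
  also have "?c + a X = d X + (real (Suc k) + 2) * a X"
    by (simp add: algebra_simps)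
  finally show ?case .
qed

end

lemmas torus_brackets = br_f0_X br_f1_X br_g_X br_X_f0 br_X_f1 br_X_g_0 br_X_g_Suc

end


section \<open>The isomorphism onto \<open>g\<close>\<close>

text \<open>The basis \<open>e 1, \<dots>, e (n + 2)\<close> corresponds to
  \<open>f0 + f1, b 2, f1, g 0, \<dots>, g (n - 4), A, B\<close>.\<close>

context L2_nilradical_extension
begin

text \<open>\<open>b 0\<close> and \<open>b 1\<close> are eigenvectors modulo \<open>F 2\<close>,
  where the eigenvalues of \<open>h\<close> are at least 3, so the defects can be removed by solving
  shifted equations there.\<close>

lemma exists_eigenbasis:
  assumes "a h = 1" "d h = 2"
  obtains f0 f1 where "L2_eigenbasis n V br b p h f0 f1"
proof -
  have w: "w h i = (if i \<le> 2 then real i + 1 else real i)" for i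
    using assms by (auto simp: w_def)
  have "br (b 0) h - 1 *\<^sub>R b 0 \<in> F 2"
    using right_mult_b0[of h] assms by simp
  then obtain u where u: "u \<in> F 2" "br u h - 1 *\<^sub>R u = br (b 0) h - 1 *\<^sub>R b 0"
    by (rule right_mult_shift_surj[where x = h and c = 1]) (auto simp: w)
  have "br (b 1) h - 2 *\<^sub>R b 1 \<in> F 2"
    using right_mult_b1[of h] assms by simp
  then obtain v where v: "v \<in> F 2" "br v h - 2 *\<^sub>R v = br (b 1) h - 2 *\<^sub>R b 1"
    by (rule right_mult_shift_surj[where x = h and c = 2]) (auto simp: w split: if_splits)
  have "L2_eigenbasis n V br b p h (b 0 - u) (b 1 - v)"
  proof (unfold_locales)
    show "br (b 0 - u) h = b 0 - u"
      using u(2) by (simp add: br_simps algebra_simps)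
    show "br (b 1 - v) h = 2 *\<^sub>R (b 1 - v)"
      using v(2) by (simp add: br_simps algebra_simps)
  qed (use assms u v in auto)
  then show thesis by (rule that)
qed

theorem isomorphic_g: "isomorphic_algebras V br (table_space (n + 2)) (g_bracket n)"
proof -
  obtain A B where A: "A \<in> V" "a A = 1" "d A = - 1" and B: "B \<in> V" "a B = 1" "d B = 0"
    and AB: "br A A = 0" "br A B = 0" "br B A = 0" "br B B = 0"
    by (rule torus)
  \<comment> \<open>An element of weights \<open>(1, 2)\<close> inside the abelian span of
    \<open>A\<close> and \<open>B\<close>, so that both commute with it.\<close>
  define h where "h = 3 *\<^sub>R B - 2 *\<^sub>R A"
  have "a h = 1" "d h = 2"
    by (simp_all add: h_def ad_simps A B)
  then obtain f0 f1 where "L2_eigenbasis n V br b p h f0 f1"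
    by (rule exists_eigenbasis)
  then interpret L2_eigenbasis n V br b p h f0 f1 .
  have Ah: "br A h = 0" and Bh: "br B h = 0"
    by (simp_all add: h_def br_simps AB)
  define E where "E i = (if i = 1 then f0 + f1 else if i = 2 then b 2 else if i = 3 then f1
    else if i \<le> n then g (i - 4) else if i = n + 1 then A else B)" for i
  let ?I = "{1..n + 2}"
  have FV: "v \<in> F i \<Longrightarrow> v \<in> V" for v i
    using F_subset_V by blast
  have EV: "E i \<in> V" for i
    using FV[OF f0_in_F] FV[OF f1_in_F] FV[OF g_in_F] A B b_in_V subspace_V
    by (auto simp: E_def intro: subspace_add)
  have V_span: "V \<subseteq> span (E ` ?I)"
  proof
    fix v assume v: "v \<in> V"
    have E: "E i \<in> span (E ` ?I)" if "1 \<le> i" "i \<le> n + 2" for i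
      using that by (intro span_base) auto
    have "f0 = E 1 - E 3" by (simp add: E_def)
    then have "f0 \<in> span (E ` ?I)"
      using n4 by (simp only:) (intro span_diff E; simp)
    moreover have "f1 \<in> span (E ` ?I)" "b 2 \<in> span (E ` ?I)"
      using E[of 3] E[of 2] n4 by (simp_all add: E_def)
    moreover have "g k \<in> span (E ` ?I)" for k
    proof (cases "k + 4 \<le> n")
      case True
      then show ?thesis using E[of "k + 4"] by (simp add: E_def)
    next
      case False
      then show ?thesis by (simp add: g_eq_0 span_zero)
    qed
    ultimately have "F 0 \<subseteq> span (E ` ?I)"
      by (intro order_trans[OF F_0_subset_span] span_minimal) auto
    \<comment> \<open>The coefficients give the combination the same weights as
      \<open>v\<close>.\<close>
    moreover have "v - ((- d v) *\<^sub>R A + (a v + d v) *\<^sub>R B) \<in> F 0"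
    proof (rule weight_zero_in_F)
      show "v - ((- d v) *\<^sub>R A + (a v + d v) *\<^sub>R B) \<in> V"
        by (intro subspace_diff subspace_add subspace_scale subspace_V v A B)
    qed (simp_all add: ad_simps A B)
    ultimately have F: "v - ((- d v) *\<^sub>R A + (a v + d v) *\<^sub>R B) \<in> span (E ` ?I)" by blast
    have "A = E (n + 1)" "B = E (n + 2)"
      using n4 by (simp_all add: E_def)
    then have "(- d v) *\<^sub>R A + (a v + d v) *\<^sub>R B \<in> span (E ` ?I)"
      by (simp only:) (intro span_add span_scale E; simp)
    from span_add[OF F this] show "v \<in> span (E ` ?I)"
      by simp
  qed
  have ind: "inj_on E ?I \<and> independent (E ` ?I)"
    using EV V_span dim_V by (intro spanning_family_independent[where V = V]) auto
  obtain \<theta> where \<theta>: "linear \<theta>" "\<forall>x\<in>E ` ?I. \<theta> x = e (inv_into ?I E x)"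
    using linear_independent_extend[of "E ` ?I" "\<lambda>x. e (inv_into ?I E x)"] ind by blast
  then have \<theta>E: "\<theta> (E i) = e i" if "1 \<le> i" "i \<le> n + 2" for i
    using that ind by (simp add: inv_into_f_f)
  note \<theta>_simps = linear_add[OF \<theta>(1)] linear_diff[OF \<theta>(1)] linear_cmul[OF \<theta>(1)] linear_neg[OF \<theta>(1)] linear_0[OF \<theta>(1)]
  have \<theta>b2: "\<theta> (b 2) = e 2" and \<theta>f1: "\<theta> f1 = e 3"
    using \<theta>E[of 2] \<theta>E[of 3] n4 by (simp_all add: E_def)
  have \<theta>f0: "\<theta> f0 = e 1 - e 3"
    using \<theta>E[of 1] n4 by (simp add: E_def \<theta>_simps \<theta>f1 eq_diff_eq)
  have \<theta>g: "\<theta> (g k) = (if k + 4 \<le> n then e (k + 4) else 0)" for k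
    using \<theta>E[of "k + 4"] by (cases "k + 4 \<le> n") (simp_all add: E_def g_eq_0 \<theta>_simps)
  have \<theta>br: "\<theta> (br (E i) (E j)) = g_table n i j" if ij: "1 \<le> i" "i \<le> n + 2" "1 \<le> j" "j \<le> n + 2" for i j
  proof -
    \<comment> \<open>Index 4 stands apart because of the extra \<open>b 2\<close> in
      \<open>br X (g 0)\<close>; from 5 on, \<open>k + 5\<close> matches
      \<open>g (Suc k)\<close>.\<close>
    have cases: "i = 1 \<or> i = 2 \<or> i = 3 \<or> i = 4 \<or> (\<exists>k. i = k + 5 \<and> k + 5 \<le> n) \<or> i = n + 1 \<or> i = n + 2"
      if "1 \<le> i" "i \<le> n + 2" for i
    proof (cases "5 \<le> i \<and> i \<le> n")
      case True
      then obtain k where "i = 5 + k" using le_Suc_ex by blast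
      with True show ?thesis by (auto simp: add.commute)
    next
      case False
      then show ?thesis using that n4 by linarith
    qed
    have E_vals: "E 1 = f0 + f1" "E 2 = b 2" "E 3 = f1" "E 4 = g 0" "k + 5 \<le> n \<Longrightarrow> E (k + 5) = g (Suc k)"
      "E (n + 1) = A" "E (n + 2) = B" for k
      using n4 by (simp_all add: E_def)
    have zero: "br f1 f1 = 0" "br f1 (b 2) = 0" "br (b 2) f1 = 0" "br (b 2) (b 2) = 0"
      "br f1 (g k) = 0" "br (g k) f1 = 0" "br (b 2) (g k) = 0" "br (g k) (b 2) = 0" "br (g k) (g l) = 0" for k l
      by (intro br_F_1_F_1 in_F_1)+
    note products = zero br_simps br_f0_f0 br_f0_f1 g_0 g_Suc br_f0_g br_b2_f0 br_f0_b2 br_b2_right AB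
      torus_brackets[OF Ah] torus_brackets[OF Bh] right_mult_b2[of A] right_mult_b2[of B] A(2,3) B(2,3)
    note images = \<theta>_simps \<theta>b2 \<theta>f0 \<theta>f1 \<theta>g
    show ?thesis
      using cases[OF ij(1,2)] cases[OF ij(3,4)]
      apply (elim disjE exE conjE)
                          apply (simp_all only: E_vals products)
                          apply (use n4 in \<open>simp_all add: images g_table_def L2_table_def scaleR_2\<close>)
      apply (arith | simp add: add.commute flip: scaleR_minus_left)+
      done
  qed
  have \<theta>hom: "\<theta> (br x y) = g_bracket n (\<theta> x) (\<theta> y)" if "x \<in> V" "y \<in> V" for x y
  proof (rule bilinear_eq[where f = "\<lambda>x y. \<theta> (br x y)" and g = "\<lambda>x y. g_bracket n (\<theta> x) (\<theta> y)"
        and S = V and T = V and B = "E ` ?I" and C = "E ` ?I"])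
    show "bilinear (\<lambda>x y. \<theta> (br x y))"
      by (simp add: bilinear_def linear_iff br_simps \<theta>_simps)
    show "bilinear (\<lambda>x y. g_bracket n (\<theta> x) (\<theta> y))"
      by (simp add: bilinear_def linear_iff \<theta>_simps bilinear_ladd[OF bilinear_g] bilinear_radd[OF bilinear_g]
        bilinear_lmul[OF bilinear_g] bilinear_rmul[OF bilinear_g])
  next
    fix x y assume "x \<in> E ` ?I" "y \<in> E ` ?I"
    then show "\<theta> (br x y) = g_bracket n (\<theta> x) (\<theta> y)"
      by (auto simp: \<theta>br \<theta>E g_bracket_e)
  qed (use that V_span in auto)
  have inj_V: "\<theta> x = 0 \<Longrightarrow> x \<in> V \<Longrightarrow> x = 0" for x
  proof -
    \<comment> \<open>A linear left inverse on \<open>V\<close>, sending \<open>e i\<close> back to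
      \<open>E i\<close>.\<close>
    obtain \<eta> where \<eta>: "linear \<eta>" "\<forall>x\<in>e ` ?I. \<eta> x = E (inv_into ?I e x)"
      using linear_independent_extend[OF independent_e[of ?I], of "\<lambda>x. E (inv_into ?I e x)"] by auto
    then have \<eta>e: "\<eta> (e i) = E i" if "i \<in> ?I" for i
      using that inj_on_subset[OF inj_e subset_UNIV, of ?I] by (simp add: inv_into_f_f)
    have "linear (\<lambda>x. \<eta> (\<theta> x))"
      using linear_compose[OF \<theta>(1) \<eta>(1)] by (simp add: o_def)
    then have "\<eta> (\<theta> x) = x" if "x \<in> V" for x
      using that V_span by (intro linear_eq_on[of "\<lambda>x. \<eta> (\<theta> x)" "\<lambda>x. x" x "E ` ?I"]) (auto simp: \<eta>e \<theta>E linear_iff)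
    then show "\<theta> x = 0 \<Longrightarrow> x \<in> V \<Longrightarrow> x = 0"
      using linear_0[OF \<eta>(1)] by metis
  qed
  have "inj_on \<theta> V"
  proof (rule inj_onI)
    fix x y assume "x \<in> V" "y \<in> V" "\<theta> x = \<theta> y"
    then show "x = y"
      using inj_V[of "x - y"] subspace_diff[OF subspace_V] by (simp add: \<theta>_simps)
  qed
  moreover have "\<theta> ` V = table_space (n + 2)"
  proof -
    have "V = span (E ` ?I)"
      using V_span EV subspace_V by (intro antisym span_minimal) auto
    then have "\<theta> ` V = span (\<theta> ` E ` ?I)"
      by (simp add: linear_span_image[OF \<theta>(1)])
    also have "\<theta> ` E ` ?I = e ` ?I"
      unfolding image_image by (intro image_cong) (auto simp: \<theta>E)
    finally show ?thesis by (simp add: table_space_def)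
  qed
  ultimately show ?thesis
    unfolding isomorphic_algebras_def using \<theta>(1) \<theta>hom by (auto simp: bij_betw_def)
qed

end

section \<open>Transfer to an arbitrary extension of \<open>L2\<close>\<close>

theorem ext_L2_isomorphic_g:
  fixes V :: "'a::real_vector set"
  assumes n: "n \<ge> 4" and ext: "solvable_indecomposable_ext_L2 n V br0"
  shows "isomorphic_algebras V br0 (table_space (n + 2)) (g_bracket n)"
proof -
  interpret right_leibniz_algebra V br0
    using ext by (simp add: solvable_indecomposable_ext_L2_def)
  have dimV: "dim V = n + 2" and solvable: "solvable_algebra V br0"
    using ext by (simp_all add: solvable_indecomposable_ext_L2_def)
  obtain N where "is_nilradical V br0 N" and iso: "isomorphic_algebras N br0 (table_space n) (L2_bracket n)"
    using ext unfolding solvable_indecomposable_ext_L2_def by blast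
  then have max: "maximal_nilpotent_ideal V br0 N"
    by (simp add: is_nilradical_def)
  then have N: "two_sided_ideal V br0 N"
    by (simp add: maximal_nilpotent_ideal_def)
  then have sN: "subspace N" and NV: "N \<subseteq> V"
    and ideal: "\<And>x y. x \<in> N \<Longrightarrow> y \<in> V \<Longrightarrow> br0 x y \<in> N" "\<And>x y. x \<in> N \<Longrightarrow> y \<in> V \<Longrightarrow> br0 y x \<in> N"
    by (auto simp: two_sided_ideal_def)
  obtain f where f: "linear f" "bij_betw f N (table_space n)"
    and hom: "\<And>x y. x \<in> N \<Longrightarrow> y \<in> N \<Longrightarrow> f (br0 x y) = L2_bracket n (f x) (f y)"
    using iso unfolding isomorphic_algebras_def by blast
  have fN: "x \<in> N \<Longrightarrow> f x \<in> table_space n" for x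
    using f(2) by (auto simp: bij_betw_def)
  have f_eqD: "x \<in> N \<Longrightarrow> y \<in> N \<Longrightarrow> f x = f y \<Longrightarrow> x = y" for x y
    using f(2) by (auto simp: bij_betw_def inj_on_def)
  \<comment> \<open>A linear projection onto \<open>V\<close> extends the bracket, meaningful only
    on \<open>V\<close>, to a bilinear map on the whole type.\<close>
  obtain P where P: "linear P" "\<And>x. P x \<in> V" "\<And>x. x \<in> V \<Longrightarrow> P x = x"
    using linear_exists_left_inverse_on[OF linear_ident subspace inj_on_id2] by auto
  define br where "br x y = br0 (P x) (P y)" for x y
  have br_eq: "br x y = br0 x y" if "x \<in> V" "y \<in> V" for x y
    using that by (simp add: br_def P)
  note f_simps = linear_add[OF f(1)] linear_diff[OF f(1)] linear_cmul[OF f(1)] linear_neg[OF f(1)] linear_0[OF f(1)]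
  define c where "c i = inv_into N f (e i)" for i
  have c: "c i \<in> N" "f (c i) = e i" if "1 \<le> i" "i \<le> n" for i
    using that e_in_table_space[of i n] f(2) unfolding c_def bij_betw_def
    by (auto intro: inv_into_into f_inv_into_f)
  define b where "b i = (if i = 0 then c 1 - c 3 else if i = 1 then c 3 else if i = 2 then c 2
    else if i < n then c (i + 1) else 0)" for i
  have bN: "b i \<in> N" for i
    using n by (auto simp: b_def intro!: subspace_diff[OF sN] subspace_0[OF sN] c)
  have fb: "f (b i) = (if i = 0 then e 1 - e 3 else if i = 1 then e 3 else if i = 2 then e 2
    else if i < n then e (i + 1) else 0)" for i
    using n c(2)[of 1] c(2)[of 2] c(2)[of 3] c(2)[of "i + 1"] by (simp add: b_def f_simps)
  \<comment> \<open>Dual to \<open>b\<close>: as \<open>e 1 = (e 1 - e 3) + e 3\<close>, the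
    coefficient of \<open>b 1\<close> is the sum of the coordinates 1 and 3.\<close>
  define p where "p i v = (if i = 1 then Poly_Mapping.lookup (f v) 1 + Poly_Mapping.lookup (f v) 3
    else Poly_Mapping.lookup (f v) (if i = 0 then 1 else if i = 2 then 2 else i + 1))" for i v
  have lookup_br: "Poly_Mapping.lookup (f (br x y)) k = (let X = Poly_Mapping.lookup (f x); Y = Poly_Mapping.lookup (f y) in
      if k = 2 then X 1 * (Y 1 + Y 3)
      else if k = 4 then (X 1 + X 3) * Y 1 - X 1 * (Y 1 + Y 3)
      else if 5 \<le> k \<and> k \<le> n then X (k - 1) * Y 1 - X 1 * Y (k - 1) else 0)"
    if "x \<in> N" "y \<in> N" for x y k
    using that NV by (simp add: br_eq subsetD hom g_bracket_eq_L2_bracket[symmetric] fN lookup_g_bracket_table_space n)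
  have brN: "br x y \<in> N" "br y x \<in> N" if "x \<in> N" for x y
    using that NV P ideal by (auto simp: br_def subset_iff)
  have br_eqI: "br x y = z" if "x \<in> N" "y \<in> N" "z \<in> N"
    and "\<And>k. Poly_Mapping.lookup (f (br x y)) k = Poly_Mapping.lookup (f z) k" for x y z
    using that by (intro f_eqD brN poly_mapping_eqI)
  have span_b: "span (range b) = N"
  proof
    show "span (range b) \<subseteq> N"
      using bN sN by (intro span_minimal) auto
    have "e i \<in> f ` span (range b)" if "i \<in> {1..n}" for i
    proof -
      have "i = 1 \<or> i = 2 \<or> i = 3 \<or> 4 \<le> i"
        using that by simp arith
      then consider "i = 1" | "i = 2" | "i = 3" | "4 \<le> i" by blast
      then show ?thesis
      proof cases
        case 1
        have "f (b 0 + b 1) = e i" using 1 by (simp add: f_simps fb)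
        then show ?thesis by (metis image_eqI rangeI span_add span_base)
      next
        case 2
        then have "f (b 2) = e i" by (simp add: fb)
        then show ?thesis by (metis image_eqI rangeI span_base)
      next
        case 3
        then have "f (b 1) = e i" by (simp add: fb)
        then show ?thesis by (metis image_eqI rangeI span_base)
      next
        case 4
        have "i - 1 \<noteq> 0" "i - 1 \<noteq> 1" "i - 1 \<noteq> 2" "i - 1 < n" "i - 1 + 1 = i"
          using 4 that by auto
        then have "f (b (i - 1)) = e i" by (simp only: fb if_True if_False)
        then show ?thesis by (metis image_eqI rangeI span_base)
      qed
    qed
    then have tab: "table_space n \<subseteq> f ` span (range b)"
      unfolding table_space_def by (intro span_minimal linear_subspace_image[OF f(1)]) auto
    show "N \<subseteq> span (range b)"
    proof
      fix v assume v: "v \<in> N"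
      then obtain u where "u \<in> span (range b)" "f v = f u"
        using tab fN by blast
      then show "v \<in> span (range b)"
        using f_eqD[OF v, of u] \<open>span (range b) \<subseteq> N\<close> by auto
    qed
  qed
  interpret L2_extension n V br b p
  proof (rule L2_extension.intro)
    show "n \<ge> 4" by (rule n)
    show "bilinear br"
      unfolding br_def bilinear_def
      by (simp add: linear_iff linear_add[OF P(1)] linear_cmul[OF P(1)] add_left add_right scale_left scale_right P(2))
    show "br x y \<in> V" for x y
      by (simp add: br_def closed P(2))
    show "br (br x y) z = br (br x z) y + br x (br y z)" for x y z
      unfolding br_def using leibniz[of "P x" "P y" "P z"] by (simp add: P closed)
    show "linear (p i)" for i
      by (auto simp: p_def linear_iff f_simps lookup_simps algebra_simps)
    show "p i (b j) = (if i = j then 1 else 0)" if "i < n" for i j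
      using that n by (auto simp: p_def fb lookup_simps)
    show "b i = 0" if "n \<le> i" for i
      using that n by (simp add: b_def)
    show "b i \<in> V" for i
      using bN NV by blast
    show "br x y \<in> span (range b)" "br y x \<in> span (range b)" if "x \<in> span (range b)" for x y
      using brN that by (simp_all add: span_b)
    show "br (b 0) (b 0) = 0" "br (b 1) (b 0) = b 3" "br (b 0) (b 1) = b 2 - b 3"
      "br (b 2) (b 0) = 0" "br (b 0) (b 2) = 0"
      using n by (intro br_eqI bN subspace_diff[OF sN] subspace_0[OF sN];
        auto simp: lookup_br bN Let_def fb f_simps lookup_simps)+
    show "br (b i) (b 0) = b (Suc i)" if "3 \<le> i" for i
      using n that by (intro br_eqI bN) (auto simp: lookup_br bN Let_def fb lookup_simps)
    show "br (b 0) (b i) = - b (Suc i)" if "3 \<le> i" for i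
      using n that by (intro br_eqI bN subspace_neg[OF sN]) (auto simp: lookup_br bN Let_def fb f_simps lookup_simps)
    show "br (b i) (b j) = 0" if "1 \<le> i" "1 \<le> j" for i j
      using n that by (intro br_eqI bN subspace_0[OF sN]) (auto simp: lookup_br bN Let_def fb f_simps lookup_simps)
  qed (rule subspace)
  have F0: "F 0 = N" by (simp add: F_0 span_b)
  interpret L2_nilradical_extension n V br b p
  proof
    show "dim V = n + 2" by (rule dimV)
    have "derived_series V br k = derived_series V br0 k" for k
      using subspace closed br_eq by (intro series_cong) simp_all
    then show "solvable_algebra V br"
      using solvable by (simp add: solvable_algebra_def)
  next
    fix M assume M: "two_sided_ideal V br M" "nilpotent_algebra M br" "F 0 \<subseteq> M"
    then have sM: "subspace M" "M \<subseteq> V"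
      by (auto simp: two_sided_ideal_def)
    have "two_sided_ideal V br0 M"
      using M(1) br_eq by (auto simp: two_sided_ideal_def subset_iff)
    moreover have "lower_central M br k = lower_central M br0 k" for k
      using M(1) sM br_eq by (intro series_cong) (auto simp: two_sided_ideal_def subset_iff)
    then have "nilpotent_algebra M br0"
      using M(2) by (simp add: nilpotent_algebra_def)
    ultimately show "M = F 0"
      using max M(3) unfolding maximal_nilpotent_ideal_def F0 by blast
  qed
  obtain \<phi> where "linear \<phi>" "bij_betw \<phi> V (table_space (n + 2))"
    "\<And>x y. x \<in> V \<Longrightarrow> y \<in> V \<Longrightarrow> \<phi> (br x y) = g_bracket n (\<phi> x) (\<phi> y)"
    using isomorphic_g unfolding isomorphic_algebras_def by blast
  then show ?thesis
    unfolding isomorphic_algebras_def using br_eq by (intro exI[of _ \<phi>]) simp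
qed

theorem theorem5p1p4:
  fixes n :: nat
  assumes "n \<ge> 4"
  shows "solvable_indecomposable_ext_L2 n (table_space (n + 2)) (g_bracket n)
    \<and> is_nilradical (table_space (n + 2)) (g_bracket n) (table_space n)
    \<and> (\<forall>x\<in>table_space n. \<forall>y\<in>table_space n. g_bracket n x y = L2_bracket n x y)
    \<and> (\<forall>(V :: 'a::real_vector set) br. solvable_indecomposable_ext_L2 n V br \<longrightarrow>
         isomorphic_algebras V br (table_space (n + 2)) (g_bracket n))
    \<and> map (DS (table_space (n + 2)) (g_bracket n)) [0..<4] = [n + 2, n, n - 2, 0]
    \<and> LS (table_space (n + 2)) (g_bracket n) 0 = n + 2
    \<and> (\<forall>k\<ge>1. LS (table_space (n + 2)) (g_bracket n) k = n)"
proof (intro conjI ballI allI impI)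
  fix k :: nat assume "k \<ge> 1"
  then obtain m where "k = Suc m" by (cases k) auto
  then show "LS (table_space (n + 2)) (g_bracket n) k = n"
    by (simp only: LS_def g_lower_central[OF assms] dim_table_space)
next
  show "LS (table_space (n + 2)) (g_bracket n) 0 = n + 2"
    by (simp add: LS_def dim_table_space)
qed (simp_all only: g_solvable_indecomposable_ext g_nilradical g_bracket_eq_L2_bracket
    ext_L2_isomorphic_g g_DS assms)

end
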